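(* Let $T>0$, $d,m\ge1$, and let $f:[0,T]\times\mathbb{R}^d\times\mathbb{R}^m\to\mathbb{R}^d$ and $g:[0,T]\times\mathbb{R}^d\times\mathbb{R}^m\to\mathbb{R}^m$ be uniformly Lipschitz continuous and bounded, and such that, for some constant $C_0\ge0$ and all $i,j\in\{1,\dots,d\}$, $k,\ell\in\{1,\dots,m\}$, $$\partial_{x_i}f^j\ge-C_0\delta_{ij},\quad\partial_{u_k}g^\ell\ge-C_0\delta_{k\ell},\quad\partial_{x_i}g^\ell\le0,\quad\partial_{u_k}f^j\le0.$$ Let $u,v:[0,T]\times\mathbb{R}^d\to\mathbb{R}^m$ be respectively a bounded viscosity subsolution and a bounded viscosity supersolution of $$\partial_tu+f(t,x,u)\cdot\nabla_xu+g(t,x,u)=0\ \text{ in }(0,T)\times\mathbb{R}^d,\qquad(\mathrm{N})$$ such that either $u$ is continuous and $v$ is lower semicontinuous, or $u$ is upper semicontinuous and $v$ is continuous. If $u(T,\cdot)\le v(T,\cdot)$, then, for all $t\in[0,T]$, $u(t,\cdot)\le v(t,\cdot)$.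
   Context: For $x,y\in\mathbb{R}^n$, $x\le y$ means $x_i\le y_i$ for all $i$ (and inequalities between $\mathbb{R}^m$-valued functions are coordinatewise); a map $\mathbb{R}^d\to\mathbb{R}^m$ is decreasing if $x\le y$ implies $\psi(x)\ge\psi(y)$. Semicontinuity and the semicontinuous envelopes $u_*,u^*$ are coordinatewise. A function $u:[0,T]\times\mathbb{R}^d\to\mathbb{R}^m$ is a viscosity subsolution (supersolution) of (N) if $u(t,\cdot)$ is decreasing for all $t\in[0,T]$ and, whenever $\phi\in C^1([0,T]\times\mathbb{R}^d,\mathbb{R})$, $i\in\{1,\dots,m\}$, and $u^{i,*}-\phi$ (resp. $u^i_*-\phi$) attains a local maximum (resp. minimum) at $(t_0,x_0)\in[0,T)\times\mathbb{R}^d$, $$-\partial_t\phi(t_0,x_0)-f(t_0,x_0,u^*(t_0,x_0))\cdot\nabla\phi(t_0,x_0)-g^i(t_0,x_0,u^*(t_0,x_0))\le0$$ (resp. $-\partial_t\phi(t_0,x_0)-f(t_0,x_0,u_*(t_0,x_0))\cdot\nabla\phi(t_0,x_0)-g^i(t_0,x_0,u_*(t_0,x_0))\ge0$). *)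

theory Defs
  imports "HOL-Analysis.Analysis"
begin

text \<open>
  Points of time-space are pairs \<open>(t, x)\<close>, arguments of the coefficients are triples
  \<open>(t, x, p)\<close>. All functions are total; only their values on the sets below are ever used.
  The order on \<^typ>\<open>real ^ 'n\<close> is the coordinatewise one of the library.
\<close>

definition time_space :: "real \<Rightarrow> (real \<times> (real ^ 'd)) set" where
  "time_space T = {0..T} \<times> UNIV"

definition coeff_dom :: "real \<Rightarrow> (real \<times> (real ^ 'd) \<times> (real ^ 'm)) set" where
  "coeff_dom T = {0..T} \<times> UNIV \<times> UNIV"

text \<open>
  Semicontinuity relative to \<open>S\<close>, and the semicontinuous envelopes on \<open>S\<close>, of vector-valued
  functions, all coordinatewise. The ball of radius \<open>r\<close> contains its centre, so the envelopes
  lie above (below) the function on \<open>S\<close>. The infima and suprema are those of the reals, hence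
  the envelopes have their usual meaning for functions that are locally bounded on \<open>S\<close>.
\<close>

definition usc_on :: "'a::metric_space set \<Rightarrow> ('a \<Rightarrow> real ^ 'm) \<Rightarrow> bool" where
  "usc_on S w \<longleftrightarrow>
     (\<forall>i. \<forall>z\<in>S. \<forall>c. w z $ i < c \<longrightarrow> (\<forall>\<^sub>F y in at z within S. w y $ i < c))"

definition lsc_on :: "'a::metric_space set \<Rightarrow> ('a \<Rightarrow> real ^ 'm) \<Rightarrow> bool" where
  "lsc_on S w \<longleftrightarrow>
     (\<forall>i. \<forall>z\<in>S. \<forall>c. c < w z $ i \<longrightarrow> (\<forall>\<^sub>F y in at z within S. c < w y $ i))"

definition upper_env :: "'a::metric_space set \<Rightarrow> ('a \<Rightarrow> real ^ 'm) \<Rightarrow> 'a \<Rightarrow> real ^ 'm" where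
  "upper_env S w z = (\<chi> i. INF r\<in>{0<..}. SUP y\<in>S \<inter> ball z r. w y $ i)"

definition lower_env :: "'a::metric_space set \<Rightarrow> ('a \<Rightarrow> real ^ 'm) \<Rightarrow> 'a \<Rightarrow> real ^ 'm" where
  "lower_env S w z = (\<chi> i. SUP r\<in>{0<..}. INF y\<in>S \<inter> ball z r. w y $ i)"

definition local_max_on :: "'a::metric_space set \<Rightarrow> ('a \<Rightarrow> real) \<Rightarrow> 'a \<Rightarrow> bool" where
  "local_max_on S h z \<longleftrightarrow> z \<in> S \<and> (\<exists>r>0. \<forall>y\<in>S \<inter> ball z r. h y \<le> h z)"

definition local_min_on :: "'a::metric_space set \<Rightarrow> ('a \<Rightarrow> real) \<Rightarrow> 'a \<Rightarrow> bool" where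
  "local_min_on S h z \<longleftrightarrow> z \<in> S \<and> (\<exists>r>0. \<forall>y\<in>S \<inter> ball z r. h z \<le> h y)"

text \<open>
  \<open>\<phi>\<close> is of class \<open>C\<^sup>1\<close> on \<open>[0,T] \<times> \<real>\<^sup>d\<close> (one-sided in time at \<open>t = 0\<close> and \<open>t = T\<close>), with time
  derivative \<open>\<phi>t\<close> and spatial gradient \<open>\<phi>x\<close>; both are unique on that set when \<open>T > 0\<close>.
\<close>

definition C1_with_derivs ::
  "real \<Rightarrow> (real \<times> (real ^ 'd) \<Rightarrow> real) \<Rightarrow> (real \<times> (real ^ 'd) \<Rightarrow> real) \<Rightarrow>
   (real \<times> (real ^ 'd) \<Rightarrow> real ^ 'd) \<Rightarrow> bool" where
  "C1_with_derivs T \<phi> \<phi>t \<phi>x \<longleftrightarrow>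
     (\<forall>z\<in>time_space T.
        (\<phi> has_derivative (\<lambda>(s, y). \<phi>t z * s + \<phi>x z \<bullet> y)) (at z within time_space T)) \<and>
     continuous_on (time_space T) \<phi>t \<and> continuous_on (time_space T) \<phi>x"

text \<open>
  Viscosity sub- and supersolutions of \<open>\<partial>\<^sub>t u + f(t,x,u) \<bullet> \<nabla>\<^sub>x u + g(t,x,u) = 0\<close>. Local extrema are
  relative to \<open>[0,T] \<times> \<real>\<^sup>d\<close>; extremum points with \<open>t\<^sub>0 = 0\<close> are included, those with \<open>t\<^sub>0 = T\<close>
  are not.
\<close>

definition viscosity_subsolution ::
  "real \<Rightarrow> (real \<times> (real ^ 'd) \<times> (real ^ 'm) \<Rightarrow> real ^ 'd) \<Rightarrow>
   (real \<times> (real ^ 'd) \<times> (real ^ 'm) \<Rightarrow> real ^ 'm) \<Rightarrow>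
   (real \<times> (real ^ 'd) \<Rightarrow> real ^ 'm) \<Rightarrow> bool" where
  "viscosity_subsolution T f g u \<longleftrightarrow>
     (\<forall>t\<in>{0..T}. antimono (\<lambda>x. u (t, x))) \<and>
     (\<forall>\<phi> \<phi>t \<phi>x i t\<^sub>0 x\<^sub>0.
        C1_with_derivs T \<phi> \<phi>t \<phi>x \<longrightarrow> t\<^sub>0 \<in> {0..<T} \<longrightarrow>
        local_max_on (time_space T) (\<lambda>z. upper_env (time_space T) u z $ i - \<phi> z) (t\<^sub>0, x\<^sub>0) \<longrightarrow>
        - \<phi>t (t\<^sub>0, x\<^sub>0)
        - f (t\<^sub>0, x\<^sub>0, upper_env (time_space T) u (t\<^sub>0, x\<^sub>0)) \<bullet> \<phi>x (t\<^sub>0, x\<^sub>0)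
        - g (t\<^sub>0, x\<^sub>0, upper_env (time_space T) u (t\<^sub>0, x\<^sub>0)) $ i \<le> 0)"

definition viscosity_supersolution ::
  "real \<Rightarrow> (real \<times> (real ^ 'd) \<times> (real ^ 'm) \<Rightarrow> real ^ 'd) \<Rightarrow>
   (real \<times> (real ^ 'd) \<times> (real ^ 'm) \<Rightarrow> real ^ 'm) \<Rightarrow>
   (real \<times> (real ^ 'd) \<Rightarrow> real ^ 'm) \<Rightarrow> bool" where
  "viscosity_supersolution T f g v \<longleftrightarrow>
     (\<forall>t\<in>{0..T}. antimono (\<lambda>x. v (t, x))) \<and>
     (\<forall>\<phi> \<phi>t \<phi>x i t\<^sub>0 x\<^sub>0.
        C1_with_derivs T \<phi> \<phi>t \<phi>x \<longrightarrow> t\<^sub>0 \<in> {0..<T} \<longrightarrow>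
        local_min_on (time_space T) (\<lambda>z. lower_env (time_space T) v z $ i - \<phi> z) (t\<^sub>0, x\<^sub>0) \<longrightarrow>
        - \<phi>t (t\<^sub>0, x\<^sub>0)
        - f (t\<^sub>0, x\<^sub>0, lower_env (time_space T) v (t\<^sub>0, x\<^sub>0)) \<bullet> \<phi>x (t\<^sub>0, x\<^sub>0)
        - g (t\<^sub>0, x\<^sub>0, lower_env (time_space T) v (t\<^sub>0, x\<^sub>0)) $ i \<ge> 0)"

text \<open>
  Partial derivatives of the coefficients. Since these are only Lipschitz continuous, a
  condition on a partial derivative is a condition at Lebesgue-almost every point of
  \<open>[0,T] \<times> \<real>\<^sup>d \<times> \<real>\<^sup>m\<close>; by Rademacher's theorem, the derivative exists at almost every point.
\<close>

definition has_partial_x ::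
  "(real \<times> (real ^ 'd) \<times> (real ^ 'm) \<Rightarrow> real) \<Rightarrow> 'd \<Rightarrow> real \<Rightarrow>
   real \<times> (real ^ 'd) \<times> (real ^ 'm) \<Rightarrow> bool" where
  "has_partial_x h i D z \<longleftrightarrow>
     ((\<lambda>s. h (z + s *\<^sub>R (0, axis i 1, 0))) has_real_derivative D) (at 0)"

definition has_partial_u ::
  "(real \<times> (real ^ 'd) \<times> (real ^ 'm) \<Rightarrow> real) \<Rightarrow> 'm \<Rightarrow> real \<Rightarrow>
   real \<times> (real ^ 'd) \<times> (real ^ 'm) \<Rightarrow> bool" where
  "has_partial_u h k D z \<longleftrightarrow>
     ((\<lambda>s. h (z + s *\<^sub>R (0, 0, axis k 1))) has_real_derivative D) (at 0)"

abbreviation ae_on_dom ::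
  "real \<Rightarrow> (real \<times> (real ^ 'd) \<times> (real ^ 'm) \<Rightarrow> bool) \<Rightarrow> bool" where
  "ae_on_dom T P \<equiv> (AE z in lborel. z \<in> coeff_dom T \<longrightarrow> P z)"

definition kronecker :: "'a \<Rightarrow> 'a \<Rightarrow> real" where
  "kronecker i j = (if i = j then 1 else 0)"

end

theory Submission
  imports Defs
begin

text \<open>
  The naive attempt to bound \<open>M(t) = max\<^sub>i sup\<^sub>x (u\<^sup>i(t,x) - v\<^sup>i(t,x))\<close> by doubling variables fails:
  the drift \<open>f\<close> depends on the unknown, so the difference of the two viscosity inequalities
  contains a term of size \<open>M |p|\<close>, where the momentum \<open>p\<close> may be unbounded since neither \<open>u\<close> nor \<open>v\<close>
  is Lipschitz. What the equation does propagate is an order between the \<^emph>\<open>graphs\<close>, in which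
  position and value may both be wrong by the same slack \<open>\<omega> > 0\<close>:
  \<open>x\<^sub>j \<ge> y\<^sub>j + \<omega> for all j  implies  u(t,x) \<le> v(t,y) + \<omega>\<close>.
  This is a kind of Levy distance between decreasing maps.

  To propagate it, maximise \<open>u\<^sup>i(t,x) - v\<^sup>i(s,y) - \<omega>\<close> with quadratic penalties for violating
  \<open>x\<^sub>j - y\<^sub>j \<ge> \<omega>\<close> and \<open>t = s\<close>. The penalty of the \<open>j\<close>-th constraint contributes a multiplier
  \<open>q\<^sub>j \<ge> 0\<close> to \<open>-p\<^sub>j\<close>, and \<open>q\<^sub>j > 0\<close> only if \<open>x\<^sub>j - y\<^sub>j < \<omega>\<close>, while \<open>y \<le> x\<close>. Since \<open>f\<^sup>j\<close> is
  increasing in the other positions and decreasing in the values, the drifts at the two points are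
  then in the right order up to an error of order \<open>\<omega>\<close>; the same holds for \<open>g\<^sup>i\<close>, because \<open>i\<close> is the
  component with the largest gap. All errors are at most a constant times \<open>(1 + q\<^sub>1 + ... + q\<^sub>d) \<omega>\<close>.
  As \<open>\<omega>\<close> enters the constraints as well as the value, its time derivative enters with the very same
  factor \<open>1 + q\<^sub>1 + ... + q\<^sub>d\<close>, and so \<open>\<omega>\<close> of the form \<open>exp (K (T - t)) (...)\<close> with large \<open>K\<close> absorbs
  everything, however large the multipliers are (\<open>no_interior_maximum\<close>).

  The argument also needs the gap \<open>u\<^sup>i - v\<^sup>i\<close> at the maximum to be comparable to \<open>\<omega>\<close>. This is
  achieved by working at the smallest level of slack for which the order holds on all of \<open>[0,T]\<close>
  (\<open>slack_level_not_critical\<close>). That the order still holds at this smallest level is where the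
  continuity of one of the two functions is needed. Non-compactness of space is dealt with by
  letting the slack grow slowly at infinity. Hence the smallest admissible level of the slack is
  zero (\<open>slack_ordered_zero\<close>), and a small enough growth rate then gives \<open>u(t, x + a) \<le> v(t, x - b) + (a + b)\<close> for small diagonal shifts;
  continuity of one of the functions removes the shifts.

  A separate, measure-theoretic part turns the almost-everywhere sign conditions on the derivatives
  of the coefficients into pointwise monotonicity.
\<close>

section \<open>Monotonicity from almost-everywhere signs of derivatives\<close>

text \<open>
  Adding \<open>\<epsilon> s\<close> makes the derivative positive off a null set \<open>Z\<close>. If the new function \<open>\<psi>\<close> dropped
  from \<open>a\<close> to \<open>b\<close>, it would cross every level in between. The image \<open>\<psi> ` Z\<close> is null because \<open>\<psi>\<close> is
  Lipschitz, so some level \<open>c\<close> is not attained on \<open>Z\<close>; but at the last point of level \<open>c\<close> the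
  function cannot have a positive derivative.
\<close>

lemma lipschitz_ae_nonneg_deriv_imp_mono:
  fixes \<phi> :: "real \<Rightarrow> real"
  assumes lip: "L-lipschitz_on UNIV \<phi>"
    and ae: "AE s in lborel. \<exists>D. (\<phi> has_real_derivative D) (at s) \<and> D \<ge> 0"
    and "a \<le> b"
  shows "\<phi> a \<le> \<phi> b"
proof (rule field_le_epsilon)
  fix \<epsilon>' :: real assume "\<epsilon>' > 0"
  define \<epsilon> where "\<epsilon> = \<epsilon>' / (b - a + 1)"
  have \<epsilon>: "\<epsilon> > 0" "\<epsilon> * (b - a) \<le> \<epsilon>'"
    using \<open>\<epsilon>' > 0\<close> \<open>a \<le> b\<close> by (auto simp: \<epsilon>_def field_simps)
  define \<psi> where "\<psi> s = \<phi> s + \<epsilon> * s" for s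
  have lip\<psi>: "\<bar>\<psi> y - \<psi> x\<bar> \<le> (L + \<epsilon>) * \<bar>y - x\<bar>" for x y
  proof -
    have "\<bar>\<phi> y - \<phi> x\<bar> \<le> L * \<bar>y - x\<bar>"
      using lipschitz_onD[OF lip, of y x] by (simp add: dist_real_def)
    moreover have "\<psi> y - \<psi> x = (\<phi> y - \<phi> x) + \<epsilon> * (y - x)"
      by (simp add: \<psi>_def algebra_simps)
    moreover have "\<bar>\<epsilon> * (y - x)\<bar> = \<epsilon> * \<bar>y - x\<bar>"
      using \<epsilon> by (simp add: abs_mult)
    ultimately show ?thesis by (simp add: algebra_simps)
  qed
  have cont: "continuous_on UNIV \<psi>"
    using lipschitz_on_continuous_on[OF lip] unfolding \<psi>_def by (intro continuous_intros) auto
  obtain Z where Z: "{s. \<not> (\<exists>D. (\<phi> has_real_derivative D) (at s) \<and> D \<ge> 0)} \<subseteq> Z"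
    "Z \<in> null_sets lborel"
    using AE_E[OF ae] by (auto simp: null_sets_def)
  have "negligible Z"
    using Z(2) by (simp add: negligible_iff_null_sets null_sets_completionI)
  then have "negligible (\<psi> ` Z)"
  proof (rule negligible_locally_Lipschitz_image[rotated])
    show "\<exists>T B. open T \<and> x \<in> T \<and> (\<forall>y\<in>Z \<inter> T. norm (\<psi> y - \<psi> x) \<le> B * norm (y - x))" for x
      using lip\<psi> by (intro exI[of _ UNIV] exI[of _ "L + \<epsilon>"]) auto
  qed simp
  have "\<psi> a \<le> \<psi> b"
  proof (rule ccontr)
    assume "\<not> \<psi> a \<le> \<psi> b"
    then have "\<not> negligible {\<psi> b<..<\<psi> a}"
      by (intro open_not_negligible) auto
    then obtain c where c: "\<psi> b < c" "c < \<psi> a" "c \<notin> \<psi> ` Z"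
      using negligible_subset[OF \<open>negligible (\<psi> ` Z)\<close>] by (metis greaterThanLessThan_iff subsetI)
    define C where "C = {s\<in>{a..b}. c \<le> \<psi> s}"
    have "C = {a..b} \<inter> {s. c \<le> \<psi> s}" by (auto simp: C_def)
    then have "compact C"
      using cont by (auto intro!: compact_Int_closed closed_Collect_le)
    moreover have "C \<noteq> {}" using c \<open>a \<le> b\<close> by (auto simp: C_def intro!: exI[of _ a])
    ultimately have "\<exists>s\<in>C. \<forall>s'\<in>C. s' \<le> s" by (rule compact_attains_sup)
    then obtain s where s: "s \<in> C" "\<And>s'. s' \<in> C \<Longrightarrow> s' \<le> s" by blast
    have sb: "s < b" using s(1) c by (cases "s = b") (auto simp: C_def)
    have less: "\<psi> s' < c" if "s < s'" "s' \<le> b" for s'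
      using s(2)[of s'] that s(1) by (force simp: C_def)
    have "\<psi> s \<le> c"
    proof (rule tendsto_upperbound)
      have "isCont \<psi> s" using cont by (simp add: continuous_on_eq_continuous_at)
      then show "(\<psi> \<longlongrightarrow> \<psi> s) (at_right s)"
        unfolding isCont_def by (rule filterlim_mono) (auto simp: at_le)
      show "\<forall>\<^sub>F x in at_right s. \<psi> x \<le> c"
        using eventually_at_right_real[OF sb] by eventually_elim (use less in \<open>auto intro: less_imp_le\<close>)
    qed auto
    then have "\<psi> s = c" using s(1) by (auto simp: C_def)
    then have "s \<notin> Z" using c by auto
    then obtain D where D: "(\<phi> has_real_derivative D) (at s)" "D \<ge> 0" using Z(1) by auto
    have "(\<psi> has_real_derivative D + \<epsilon>) (at s)"
      unfolding \<psi>_def by (auto intro!: derivative_eq_intros D)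
    from DERIV_pos_inc_right[OF this] D \<epsilon> obtain d where
      d: "d > 0" "\<And>h. 0 < h \<Longrightarrow> h < d \<Longrightarrow> \<psi> s < \<psi> (s + h)" by auto
    define h where "h = min (d / 2) (b - s)"
    have "\<psi> s < \<psi> (s + h)" using d sb by (intro d) (auto simp: h_def)
    moreover have "\<psi> (s + h) < c" using d sb by (intro less) (auto simp: h_def)
    ultimately show False using \<open>\<psi> s = c\<close> by simp
  qed
  then show "\<phi> a \<le> \<phi> b + \<epsilon>'" using \<epsilon> by (simp add: \<psi>_def algebra_simps)
qed

text \<open>
  Fubini in the coordinates \<open>(z, s)\<close> rather than in coordinates adapted to \<open>e\<close>: for every fixed \<open>s\<close>
  the exceptional set is a translate of a null set.
\<close>

lemma ae_on_lines:
  fixes e :: "'a::euclidean_space"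
  assumes "AE z in lborel. P z"
  shows "AE z in lborel. AE s::real in lborel. P (z + s *\<^sub>R e)"
proof -
  obtain N where N: "{z. \<not> P z} \<subseteq> N" "N \<in> null_sets lborel"
    using AE_E[OF assms] by (auto simp: null_sets_def)
  have Nb[measurable]: "N \<in> sets borel" using N(2) by (auto simp: null_sets_def)
  have "AE z in lborel. z + s *\<^sub>R e \<notin> N" for s :: real
  proof -
    have "AE z in distr lborel borel ((+) (s *\<^sub>R e)). z \<notin> N"
      unfolding lborel_distr_plus using N(2) by (rule AE_not_in)
    then show ?thesis
      by (subst (asm) AE_distr_iff) (auto simp: add.commute)
  qed
  then have "AE s::real in lborel. AE z in lborel. z + s *\<^sub>R e \<notin> N" by simp
  moreover have "{x \<in> space (lborel \<Otimes>\<^sub>M lborel). fst x + (snd x :: real) *\<^sub>R e \<notin> N}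
      \<in> sets (lborel \<Otimes>\<^sub>M lborel)"
    by measurable
  ultimately have "AE z in lborel. AE s::real in lborel. z + s *\<^sub>R e \<notin> N"
    by (subst lborel_pair.AE_commute) auto
  then show ?thesis
    using N(1) by (auto elim!: eventually_mono)
qed

text \<open>
  On almost every line in the direction \<open>e\<close> the one-dimensional statement applies. The base points
  of these lines are dense in \<open>S\<close>, because \<open>S\<close> lies in the closure of its interior, and continuity extends the
  inequality to the remaining lines.
\<close>

lemma lipschitz_ae_nonneg_directional_deriv:
  fixes h :: "'a::euclidean_space \<Rightarrow> real"
  assumes lip: "L-lipschitz_on S h"
    and ae: "AE z in lborel. z \<in> S \<longrightarrow>
      (\<exists>D. ((\<lambda>s. h (z + s *\<^sub>R e)) has_real_derivative D) (at 0) \<and> D \<ge> 0)"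
    and line: "\<And>z s. z \<in> S \<Longrightarrow> z + s *\<^sub>R e \<in> S"
    and S: "S \<subseteq> closure (interior S)"
    and z: "z \<in> S" and "0 \<le> s"
  shows "h z \<le> h (z + s *\<^sub>R e)"
proof -
  define G where "G = {z. z \<in> S \<longrightarrow> h z \<le> h (z + s *\<^sub>R e)}"
  have good: "AE z in lborel. z \<in> G"
    using ae_on_lines[OF ae, of e]
  proof eventually_elim
    case (elim z)
    show "z \<in> G" unfolding G_def
    proof safe
      assume z: "z \<in> S"
      have "(L * norm e)-lipschitz_on UNIV (\<lambda>r. h (z + r *\<^sub>R e))"
      proof (rule lipschitz_onI)
        fix r q :: real
        have "dist (h (z + r *\<^sub>R e)) (h (z + q *\<^sub>R e)) \<le> L * dist (z + r *\<^sub>R e) (z + q *\<^sub>R e)"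
          using lipschitz_onD[OF lip] line z by blast
        also have "dist (z + r *\<^sub>R e) (z + q *\<^sub>R e) = norm e * dist r q"
          by (simp add: dist_norm flip: scaleR_diff_left)
        finally show "dist (h (z + r *\<^sub>R e)) (h (z + q *\<^sub>R e)) \<le> L * norm e * dist r q" by simp
        show "0 \<le> L * norm e" using lipschitz_on_nonneg[OF lip] by simp
      qed
      moreover have "AE r in lborel.
          \<exists>D. ((\<lambda>r. h (z + r *\<^sub>R e)) has_real_derivative D) (at r) \<and> D \<ge> 0"
        using elim
      proof eventually_elim
        case (elim r)
        then obtain D where D: "((\<lambda>q. h (z + r *\<^sub>R e + q *\<^sub>R e)) has_real_derivative D) (at 0)" "D \<ge> 0"
          using line z by blast
        have "((\<lambda>r. h (z + r *\<^sub>R e)) has_real_derivative D) (at (0 + r))"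
          by (subst DERIV_shift) (use D(1) in \<open>simp add: algebra_simps\<close>)
        then show ?case using D(2) by auto
      qed
      ultimately show "h z \<le> h (z + s *\<^sub>R e)"
        using lipschitz_ae_nonneg_deriv_imp_mono[of _ "\<lambda>r. h (z + r *\<^sub>R e)" 0 s] \<open>0 \<le> s\<close> by simp
    qed
  qed
  have dense: "z \<in> closure (G \<inter> interior S)"
  proof -
    have "interior S \<subseteq> closure (G \<inter> interior S)"
    proof
      fix w assume w: "w \<in> interior S"
      show "w \<in> closure (G \<inter> interior S)"
      proof (subst closure_approachable, safe)
        fix \<epsilon> :: real assume "\<epsilon> > 0"
        let ?U = "ball w \<epsilon> \<inter> interior S"
        obtain N where N: "{z. z \<notin> G} \<subseteq> N" "N \<in> null_sets lborel"
          using AE_E[OF good] by (auto simp: null_sets_def)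
        then have "negligible N" by (simp add: negligible_iff_null_sets null_sets_completionI)
        moreover have "\<not> negligible ?U"
          using w \<open>\<epsilon> > 0\<close> by (intro open_not_negligible) (auto simp: disjoint_iff intro!: exI[of _ w])
        ultimately have "\<not> ?U \<subseteq> N" using negligible_subset by blast
        then obtain y where "y \<in> ?U" "y \<in> G" using N(1) by blast
        then show "\<exists>y\<in>G \<inter> interior S. dist y w < \<epsilon>"
          by (auto simp: dist_commute intro!: bexI[of _ y])
      qed
    qed
    then show ?thesis using S z closure_minimal[of "interior S"] by blast
  qed
  then obtain x where x: "\<And>n. x n \<in> G \<inter> interior S" "x \<longlonglongrightarrow> z"
    unfolding closure_sequential by blast
  have xS: "x n \<in> S" for n using x(1) interior_subset by blast
  have cont: "continuous_on S h" using lip by (rule lipschitz_on_continuous_on)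
  have "(\<lambda>n. h (x n)) \<longlonglongrightarrow> h z"
    using cont x(2) z xS by (auto intro: continuous_on_tendsto_compose)
  moreover have "(\<lambda>n. h (x n + s *\<^sub>R e)) \<longlonglongrightarrow> h (z + s *\<^sub>R e)"
    using z xS line x(2) by (intro continuous_on_tendsto_compose[OF cont] tendsto_intros) auto
  moreover have "h (x n) \<le> h (x n + s *\<^sub>R e)" for n using x(1)[of n] xS[of n] by (auto simp: G_def)
  ultimately show ?thesis by (intro LIMSEQ_le) auto
qed

text \<open>
  Changing the coordinates in \<open>A\<close> one after the other. Only these may differ, which is what a
  quasimonotone function, monotone in all coordinates but one, allows.
\<close>

lemma mono_from_axes:
  fixes F :: "real ^ 'n \<Rightarrow> real"
  assumes axes: "\<And>k y s. k \<in> A \<Longrightarrow> 0 \<le> s \<Longrightarrow> F y \<le> F (y + s *\<^sub>R axis k 1)"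
    and "y \<le> x" and "\<And>k. k \<notin> A \<Longrightarrow> x $ k = y $ k"
  shows "F y \<le> F x"
proof -
  define X where "X B = (\<chi> k. if k \<in> B then x $ k else y $ k)" for B
  have "F y \<le> F (X B)" if "B \<subseteq> A" for B
    using finite[of B] that
  proof (induction B rule: finite_induct)
    case empty
    have "X {} = y" by (simp add: X_def vec_eq_iff)
    then show ?case by simp
  next
    case (insert k B)
    have "X (insert k B) = X B + (x $ k - y $ k) *\<^sub>R axis k 1"
      using insert by (auto simp: X_def vec_eq_iff axis_def)
    moreover have "x $ k - y $ k \<ge> 0" using \<open>y \<le> x\<close> by (simp add: less_eq_vec_def)
    ultimately have "F (X B) \<le> F (X (insert k B))" using axes[of k] insert by simp
    then show ?case using insert by auto
  qed
  moreover have "X A = x" using assms(3) by (auto simp: X_def vec_eq_iff)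
  ultimately show ?thesis by (metis order_refl)
qed

lemma coeff_dom_regular:
  assumes "T > 0"
  shows "coeff_dom T \<subseteq> closure (interior (coeff_dom T))"
  using assms
  by (simp add: coeff_dom_def interior_Times closure_Times)

lemma component_lipschitz_on:
  fixes f :: "'a::metric_space \<Rightarrow> real ^ 'n"
  assumes "L-lipschitz_on S f"
  shows "L-lipschitz_on S (\<lambda>z. f z $ j)"
proof (rule lipschitz_onI)
  fix x y assume "x \<in> S" "y \<in> S"
  then show "dist (f x $ j) (f y $ j) \<le> L * dist x y"
    using lipschitz_onD[OF assms] dist_vec_nth_le order_trans by blast
qed (rule lipschitz_on_nonneg[OF assms])

lemma coefficient_mono_x:
  fixes h :: "real \<times> (real ^ 'd) \<times> (real ^ 'm) \<Rightarrow> real"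
  assumes "T > 0" and lip: "L-lipschitz_on (coeff_dom T) h"
    and ae: "\<And>i. i \<in> A \<Longrightarrow> ae_on_dom T (\<lambda>z. \<exists>D. has_partial_x h i D z \<and> D \<ge> 0)"
    and t: "t \<in> {0..T}" and "y \<le> x" and "\<And>i. i \<notin> A \<Longrightarrow> x $ i = y $ i"
  shows "h (t, y, p) \<le> h (t, x, p)"
proof (rule mono_from_axes[where A = A and F = "\<lambda>x. h (t, x, p)"])
  fix i y and s :: real assume "i \<in> A" "0 \<le> s"
  have "h (t, y, p) \<le> h ((t, y, p) + s *\<^sub>R (0, axis i 1, 0))"
    using ae[OF \<open>i \<in> A\<close>] t \<open>0 \<le> s\<close> coeff_dom_regular[OF \<open>T > 0\<close>] unfolding has_partial_x_def
    by (intro lipschitz_ae_nonneg_directional_deriv[OF lip]) (auto simp: coeff_dom_def)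
  then show "h (t, y, p) \<le> h (t, y + s *\<^sub>R axis i 1, p)" by simp
qed (use assms in auto)

lemma coefficient_mono_u:
  fixes h :: "real \<times> (real ^ 'd) \<times> (real ^ 'm) \<Rightarrow> real"
  assumes "T > 0" and lip: "L-lipschitz_on (coeff_dom T) h"
    and ae: "\<And>k. k \<in> A \<Longrightarrow> ae_on_dom T (\<lambda>z. \<exists>D. has_partial_u h k D z \<and> D \<ge> 0)"
    and t: "t \<in> {0..T}" and "q \<le> p" and "\<And>k. k \<notin> A \<Longrightarrow> p $ k = q $ k"
  shows "h (t, x, q) \<le> h (t, x, p)"
proof (rule mono_from_axes[where A = A and F = "\<lambda>p. h (t, x, p)"])
  fix k q and s :: real assume "k \<in> A" "0 \<le> s"
  have "h (t, x, q) \<le> h ((t, x, q) + s *\<^sub>R (0, 0, axis k 1))"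
    using ae[OF \<open>k \<in> A\<close>] t \<open>0 \<le> s\<close> coeff_dom_regular[OF \<open>T > 0\<close>] unfolding has_partial_u_def
    by (intro lipschitz_ae_nonneg_directional_deriv[OF lip]) (auto simp: coeff_dom_def)
  then show "h (t, x, q) \<le> h (t, x, q + s *\<^sub>R axis k 1)" by simp
qed (use assms in auto)

lemma has_partial_x_uminus:
  assumes "has_partial_x h i D z"
  shows "has_partial_x (\<lambda>y. - h y) i (- D) z"
  using assms unfolding has_partial_x_def by (rule DERIV_minus)

lemma has_partial_u_uminus:
  assumes "has_partial_u h i D z"
  shows "has_partial_u (\<lambda>y. - h y) i (- D) z"
  using assms unfolding has_partial_u_def by (rule DERIV_minus)

section \<open>Semicontinuous functions and their envelopes\<close>

text \<open>
  Together with the next lemma this reduces lower semicontinuity to upper semicontinuity.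
\<close>

lemma lower_env_uminus:
  "lower_env S w z = - upper_env S (\<lambda>y. - w y) z"
proof -
  have "(SUP r\<in>{0<..}. INF y\<in>S \<inter> ball z r. w y $ i)
      = - (INF r\<in>{0<..}. SUP y\<in>S \<inter> ball z r. - w y $ i)" for i
    by (simp add: Inf_real_def image_image)
  then show ?thesis by (simp add: lower_env_def upper_env_def vec_eq_iff)
qed

lemma usc_on_uminus: "lsc_on S w \<Longrightarrow> usc_on S (\<lambda>z. - w z)"
  unfolding usc_on_def lsc_on_def
proof (intro allI ballI impI)
  fix i z c
  assume *: "\<forall>i. \<forall>z\<in>S. \<forall>c<w z $ i. \<forall>\<^sub>F y in at z within S. c < w y $ i"
    and "z \<in> S" "(- w z) $ i < c"
  then have "\<forall>\<^sub>F y in at z within S. - c < w y $ i" by simp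
  then show "\<forall>\<^sub>F y in at z within S. (- w y) $ i < c" by eventually_elim simp
qed

lemma upper_env_eq:
  assumes bdd: "bounded (w ` S)" and usc: "usc_on S w" and z: "z \<in> S"
  shows "upper_env S w z = w z"
proof -
  obtain B where B: "\<And>y. y \<in> S \<Longrightarrow> norm (w y) \<le> B"
    using bdd by (auto simp: bounded_iff)
  have bound: "\<bar>w y $ i\<bar> \<le> B" if "y \<in> S" for y i
    using B[OF that] component_le_norm_cart[of "w y" i] by linarith
  have "(INF r\<in>{0<..}. SUP y\<in>S \<inter> ball z r. w y $ i) = w z $ i" for i
  proof -
    have le: "w z $ i \<le> (SUP y\<in>S \<inter> ball z r. w y $ i)" if "r > 0" for r
      using z that by (intro cSUP_upper2[where x = z] bdd_aboveI2[where M = B])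
        (use bound in \<open>auto simp: abs_le_iff\<close>)
    have "(INF r\<in>{0<..}. SUP y\<in>S \<inter> ball z r. w y $ i) \<le> c" if "w z $ i < c" for c
    proof -
      have "\<forall>\<^sub>F y in at z within S. w y $ i < c"
        using usc z that by (auto simp: usc_on_def)
      then obtain r where r: "r > 0" "\<And>y. y \<in> S \<Longrightarrow> y \<noteq> z \<Longrightarrow> dist y z < r \<Longrightarrow> w y $ i < c"
        by (auto simp: eventually_at)
      have "w y $ i \<le> c" if "y \<in> S \<inter> ball z r" for y
        using r(2)[of y] that \<open>w z $ i < c\<close> by (cases "y = z") (auto simp: dist_commute)
      then have "(SUP y\<in>S \<inter> ball z r. w y $ i) \<le> c"
        using z r(1) by (intro cSUP_least) auto
      then show ?thesis
        using r(1) le by (intro cINF_lower2[where x = r]) (auto intro!: bdd_belowI2)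
    qed
    then have "(INF r\<in>{0<..}. SUP y\<in>S \<inter> ball z r. w y $ i) \<le> w z $ i"
      by (rule dense_ge)
    moreover have "w z $ i \<le> (INF r\<in>{0<..}. SUP y\<in>S \<inter> ball z r. w y $ i)"
      by (intro cINF_greatest le) auto
    ultimately show ?thesis by simp
  qed
  then show ?thesis by (simp add: upper_env_def vec_eq_iff)
qed

lemma lower_env_eq:
  assumes "bounded (w ` S)" and "lsc_on S w" and "z \<in> S"
  shows "lower_env S w z = w z"
proof -
  have "bounded ((\<lambda>y. - w y) ` S)"
    using assms(1) by (auto simp: bounded_iff)
  then show ?thesis
    using upper_env_eq[OF _ usc_on_uminus[OF assms(2)] assms(3)] by (simp add: lower_env_uminus)
qed

lemma continuous_imp_usc_on:
  assumes "continuous_on S w"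
  shows "usc_on S w"
  unfolding usc_on_def
proof (intro allI ballI impI)
  fix i z c assume "z \<in> S" and less: "w z $ i < c"
  have "((\<lambda>y. w y $ i) \<longlongrightarrow> w z $ i) (at z within S)"
    using assms \<open>z \<in> S\<close> by (auto simp: continuous_on_def intro: tendsto_vec_nth)
  then show "\<forall>\<^sub>F y in at z within S. w y $ i < c" using less by (rule order_tendstoD(2))
qed

lemma continuous_imp_lsc_on:
  assumes "continuous_on S w"
  shows "lsc_on S w"
  unfolding lsc_on_def
proof (intro allI ballI impI)
  fix i z c assume "z \<in> S" and less: "c < w z $ i"
  have "((\<lambda>y. w y $ i) \<longlongrightarrow> w z $ i) (at z within S)"
    using assms \<open>z \<in> S\<close> by (auto simp: continuous_on_def intro: tendsto_vec_nth)
  then show "\<forall>\<^sub>F y in at z within S. c < w y $ i" using less by (rule order_tendstoD(1))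
qed

lemma usc_on_sequence:
  assumes usc: "usc_on S w" and zS: "z \<in> S" and aS: "\<And>n. a n \<in> S" and a: "a \<longlonglongrightarrow> z" and "\<epsilon> > 0"
  shows "\<forall>\<^sub>F n in sequentially. w (a n) $ i < w z $ i + \<epsilon>"
proof -
  have "\<forall>\<^sub>F y in at z within S. w y $ i < w z $ i + \<epsilon>"
    using usc zS \<open>\<epsilon> > 0\<close> by (auto simp: usc_on_def)
  then have "\<forall>\<^sub>F y in nhds z. y \<in> S \<longrightarrow> w y $ i < w z $ i + \<epsilon>"
    using \<open>\<epsilon> > 0\<close> by (auto simp: eventually_at_filter elim!: eventually_mono)
  then have "\<forall>\<^sub>F n in sequentially. a n \<in> S \<longrightarrow> w (a n) $ i < w z $ i + \<epsilon>"
    using a by (rule eventually_compose_filterlim)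
  then show ?thesis using aS by simp
qed

lemma lsc_on_sequence:
  assumes "lsc_on S w" and "z \<in> S" and "\<And>n. a n \<in> S" and "a \<longlonglongrightarrow> z" and "\<epsilon> > 0"
  shows "\<forall>\<^sub>F n in sequentially. w z $ i - \<epsilon> < w (a n) $ i"
  using usc_on_sequence[OF usc_on_uminus[OF assms(1)] assms(2-5), of i]
  by eventually_elim simp

text \<open>
  Upper semicontinuity is required along sequences in \<open>K\<close> only. In this form it is inherited by sums
  and by compositions with projections, which is how it will be verified.
\<close>

lemma compact_usc_attains_sup:
  fixes F :: "'a::metric_space \<Rightarrow> real"
  assumes "compact K" and "K \<noteq> {}" and bdd: "bdd_above (F ` K)"
    and usc: "\<And>a z \<epsilon>. (\<And>n. a n \<in> K) \<Longrightarrow> z \<in> K \<Longrightarrow> a \<longlonglongrightarrow> z \<Longrightarrow> \<epsilon> > 0 \<Longrightarrow>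
      \<forall>\<^sub>F n in sequentially. F (a n) < F z + \<epsilon>"
  shows "\<exists>z\<in>K. \<forall>y\<in>K. F y \<le> F z"
proof -
  define M where "M = Sup (F ` K)"
  have "\<exists>z\<in>K. M - 1 / Suc n < F z" for n
  proof -
    have "M - 1 / Suc n < Sup (F ` K)" by (simp add: M_def)
    then show ?thesis using assms(2) bdd by (subst (asm) less_cSup_iff) auto
  qed
  then obtain a where a: "\<And>n. a n \<in> K" "\<And>n. M - 1 / Suc n < F (a n)" by metis
  obtain z r where z: "z \<in> K" "strict_mono r" "(a \<circ> r) \<longlonglongrightarrow> z"
    using \<open>compact K\<close> a(1) unfolding compact_def by blast
  have "M \<le> F z"
  proof (rule field_le_epsilon)
    fix \<epsilon> :: real assume "\<epsilon> > 0"
    have "\<forall>\<^sub>F n in sequentially. F (a (r n)) < F z + \<epsilon> / 2"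
      using usc[of "a \<circ> r" z "\<epsilon> / 2"] a z \<open>\<epsilon> > 0\<close> by simp
    moreover have "(\<lambda>n. 1 / real (Suc n)) \<longlonglongrightarrow> 0"
      using LIMSEQ_inverse_real_of_nat by (simp add: inverse_eq_divide)
    then have "\<forall>\<^sub>F n in sequentially. 1 / real (Suc (r n)) < \<epsilon> / 2"
      using \<open>\<epsilon> > 0\<close> LIMSEQ_subseq_LIMSEQ[OF _ z(2)] by (intro order_tendstoD(2)) (auto simp: o_def)
    ultimately have "\<forall>\<^sub>F n in sequentially. M \<le> F z + \<epsilon>"
    proof eventually_elim
      case (elim n)
      then show ?case using a(2)[of "r n"] by linarith
    qed
    then show "M \<le> F z + \<epsilon>" by simp
  qed
  then show ?thesis
    using z(1) bdd by (intro bexI[of _ z]) (auto simp: M_def intro: cSUP_upper2 order_trans[OF cSUP_upper])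
qed

section \<open>Calculus of test functions\<close>

text \<open>
  Closure rules by which a test function is certified through resolution along its syntax. The
  derivatives therefore come out literally as the rules produce them, with summands such as
  \<open>0 + \<beta> * (0 + 0)\<close> from constants; \<open>C1_cong\<close> tidies them up.
\<close>

lemma C1_const: "C1_with_derivs T (\<lambda>z. c) (\<lambda>z. 0) (\<lambda>z. 0)"
  by (auto simp: C1_with_derivs_def case_prod_unfold)

lemma C1_add:
  assumes "C1_with_derivs T \<phi> \<phi>t \<phi>x" and "C1_with_derivs T \<psi> \<psi>t \<psi>x"
  shows "C1_with_derivs T (\<lambda>z. \<phi> z + \<psi> z) (\<lambda>z. \<phi>t z + \<psi>t z) (\<lambda>z. \<phi>x z + \<psi>x z)"
  using assms unfolding C1_with_derivs_def
  by (auto intro!: derivative_eq_intros continuous_intros simp: case_prod_unfold algebra_simps inner_add_left)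

lemma C1_sum:
  assumes "finite J" and "\<And>j. j \<in> J \<Longrightarrow> C1_with_derivs T (\<phi> j) (\<phi>t j) (\<phi>x j)"
  shows "C1_with_derivs T (\<lambda>z. \<Sum>j\<in>J. \<phi> j z) (\<lambda>z. \<Sum>j\<in>J. \<phi>t j z) (\<lambda>z. \<Sum>j\<in>J. \<phi>x j z)"
  using assms by (induction J) (auto intro: C1_const C1_add)

lemma C1_compose:
  assumes W: "C1_with_derivs T W Wt Wx"
    and \<rho>: "\<And>r. (\<rho> has_real_derivative \<rho>' r) (at r)" and cont: "continuous_on UNIV \<rho>'"
  shows "C1_with_derivs T (\<lambda>z. \<rho> (W z)) (\<lambda>z. \<rho>' (W z) * Wt z) (\<lambda>z. \<rho>' (W z) *\<^sub>R Wx z)"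
proof -
  have dW: "(W has_derivative (\<lambda>(s, y). Wt z * s + Wx z \<bullet> y)) (at z within time_space T)"
    if "z \<in> time_space T" for z using W that by (auto simp: C1_with_derivs_def)
  then have contW: "continuous_on (time_space T) W"
    by (rule has_derivative_continuous_on)
  have cont': "continuous_on (time_space T) (\<lambda>z. \<rho>' (W z))"
    using continuous_on_compose2[OF cont contW] by simp
  have "((\<lambda>z. \<rho> (W z)) has_derivative (\<lambda>(s, y). \<rho>' (W z) * Wt z * s + (\<rho>' (W z) *\<^sub>R Wx z) \<bullet> y))
      (at z within time_space T)" if "z \<in> time_space T" for z
    using has_derivative_compose[OF dW[OF that] \<rho>[of "W z", unfolded has_field_derivative_def]]
    by (simp add: case_prod_unfold algebra_simps)
  then show ?thesis
    using W cont' by (auto simp: C1_with_derivs_def intro!: continuous_intros)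
qed

lemma C1_cmult:
  assumes "C1_with_derivs T \<phi> \<phi>t \<phi>x"
  shows "C1_with_derivs T (\<lambda>z. c * \<phi> z) (\<lambda>z. c * \<phi>t z) (\<lambda>z. c *\<^sub>R \<phi>x z)"
  using C1_compose[OF assms, of "(*) c" "\<lambda>_. c"] by (auto intro!: derivative_eq_intros)

lemma C1_mult:
  assumes "C1_with_derivs T \<phi> \<phi>t \<phi>x" and "C1_with_derivs T \<psi> \<psi>t \<psi>x"
  shows "C1_with_derivs T (\<lambda>z. \<phi> z * \<psi> z) (\<lambda>z. \<phi>t z * \<psi> z + \<phi> z * \<psi>t z)
    (\<lambda>z. \<psi> z *\<^sub>R \<phi>x z + \<phi> z *\<^sub>R \<psi>x z)"
proof -
  have "continuous_on (time_space T) \<phi>" "continuous_on (time_space T) \<psi>"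
    using assms unfolding C1_with_derivs_def by (auto intro: has_derivative_continuous_on)
  then show ?thesis
    using assms unfolding C1_with_derivs_def
    by (auto intro!: derivative_eq_intros continuous_intros simp: case_prod_unfold algebra_simps inner_add_left)
qed

lemma C1_time:
  assumes "\<And>r. (\<theta> has_real_derivative \<theta>' r) (at r)" and "continuous_on UNIV \<theta>'"
  shows "C1_with_derivs T (\<lambda>z. \<theta> (fst z)) (\<lambda>z. \<theta>' (fst z)) (\<lambda>z. 0)"
proof -
  have "C1_with_derivs T fst (\<lambda>z. 1) (\<lambda>z. 0)"
    by (auto simp: C1_with_derivs_def case_prod_unfold intro!: derivative_eq_intros)
  from C1_compose[OF this assms] show ?thesis by simp
qed

lemma C1_cong:
  assumes "C1_with_derivs T \<phi> \<phi>t \<phi>x"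
    and "\<And>z. \<phi> z = \<psi> z" and "\<And>z. \<phi>t z = \<psi>t z" and "\<And>z. \<phi>x z = \<psi>x z"
  shows "C1_with_derivs T \<psi> \<psi>t \<psi>x"
proof -
  have "\<phi> = \<psi>" "\<phi>t = \<psi>t" "\<phi>x = \<psi>x" using assms(2-4) by auto
  then show ?thesis using assms(1) by simp
qed

lemma C1_coordinate: "C1_with_derivs T (\<lambda>z. snd z $ j) (\<lambda>z. 0) (\<lambda>z. axis j 1)"
proof -
  have "((\<lambda>z. snd z $ j) has_derivative (\<lambda>z. snd z $ j)) (at z within S)"
    for z :: "real \<times> (real ^ 'a)" and S
    using bounded_linear_imp_has_derivative[OF
        bounded_linear_compose[OF bounded_linear_vec_nth bounded_linear_snd]] .
  then show ?thesis
    by (simp add: C1_with_derivs_def case_prod_unfold inner_axis')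
qed

text \<open>
  The Japanese bracket \<open>\<langle>x\<rangle> = sqrt (1 + |x|\<^sup>2)\<close>: a smooth function that grows like the norm, is at
  least \<open>1\<close> and has a gradient of norm at most \<open>1\<close>.
\<close>

definition bracket :: "'a::real_inner \<Rightarrow> real" where
  "bracket x = sqrt (1 + x \<bullet> x)"

lemma bracket_ge_1: "1 \<le> bracket x" by (simp add: bracket_def)

lemma norm_le_bracket: "norm x \<le> bracket x"
  by (simp add: bracket_def norm_eq_sqrt_inner)

lemma bracket_eq_norm: "bracket x = norm (1::real, x)"
  by (simp add: bracket_def norm_Pair power2_norm_eq_inner)

lemma bracket_add_le: "bracket (x + h) \<le> bracket x + norm h"
  using norm_triangle_ineq[of "(1::real, x)" "(0, h)"] by (simp add: bracket_eq_norm norm_Pair)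

lemma continuous_on_bracket_snd: "continuous_on S (\<lambda>z. bracket (snd z))"
  unfolding bracket_def by (intro continuous_intros)

lemma C1_bracket: "C1_with_derivs T (\<lambda>z. bracket (snd z)) (\<lambda>z. 0) (\<lambda>z. (1 / bracket (snd z)) *\<^sub>R snd z)"
proof -
  have pos: "0 < 1 + x \<bullet> x" for x :: "real ^ 'a" by (simp add: add_pos_nonneg)
  have "(bracket has_derivative (\<lambda>h. ((1 / bracket x) *\<^sub>R x) \<bullet> h)) (at x)" for x :: "real ^ 'a"
  proof -
    have sq: "((\<lambda>x. 1 + x \<bullet> x) has_derivative (\<lambda>h. x \<bullet> h + h \<bullet> x)) (at x)"
      by (auto intro!: derivative_eq_intros)
    have "((\<lambda>x. sqrt (1 + x \<bullet> x)) has_derivative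
        (\<lambda>h. (x \<bullet> h + h \<bullet> x) * (inverse (sqrt (1 + x \<bullet> x)) / 2))) (at x)"
      by (rule DERIV_compose_FDERIV[OF DERIV_real_sqrt[OF pos] sq])
    moreover have "(\<lambda>h. (x \<bullet> h + h \<bullet> x) * (inverse (sqrt (1 + x \<bullet> x)) / 2)) =
        (\<lambda>h. ((1 / bracket x) *\<^sub>R x) \<bullet> h)"
      by (simp add: fun_eq_iff bracket_def inner_commute inverse_eq_divide)
    ultimately show ?thesis unfolding bracket_def[abs_def] by simp
  qed
  then have "((\<lambda>z. bracket (snd z)) has_derivative
      (\<lambda>h. ((1 / bracket (snd z)) *\<^sub>R snd z) \<bullet> snd h)) (at z within time_space T)"
    for z :: "real \<times> (real ^ 'a)"
    using has_derivative_compose[OF has_derivative_snd[OF has_derivative_ident]] by blast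
  moreover have "bracket x \<noteq> 0" for x :: "real ^ 'a" using bracket_ge_1[of x] by simp
  then have "continuous_on S (\<lambda>z. (1 / bracket (snd z)) *\<^sub>R snd z)" for S :: "(real \<times> (real ^ 'a)) set"
    by (intro continuous_intros continuous_on_bracket_snd) auto
  ultimately show ?thesis
    by (simp add: C1_with_derivs_def case_prod_unfold)
qed

lemma norm_bracket_gradient_le: "norm ((1 / bracket x) *\<^sub>R x) \<le> 1"
  using norm_le_bracket[of x] bracket_ge_1[of x] by (simp add: divide_simps)

text \<open>
  This is the reason for penalising violated constraints quadratically: the positive part itself is
  not differentiable at \<open>0\<close>, but its square is of class \<open>C\<^sup>1\<close>.
\<close>

lemma C1_positive_part_squared:
  assumes "C1_with_derivs T W Wt Wx"
  shows "C1_with_derivs T (\<lambda>z. (max 0 (W z))\<^sup>2) (\<lambda>z. 2 * max 0 (W z) * Wt z)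
    (\<lambda>z. (2 * max 0 (W z)) *\<^sub>R Wx z)"
proof (rule C1_compose[OF assms])
  fix r :: real
  show "((\<lambda>r. (max 0 r)\<^sup>2) has_real_derivative 2 * max 0 r) (at r)"
  proof (cases "r = 0")
    case True
    have "((\<lambda>h. (max 0 h)\<^sup>2 / h) \<longlongrightarrow> 0) (at (0::real))"
    proof (rule Lim_null_comparison)
      show "\<forall>\<^sub>F h in at (0::real). norm ((max 0 h)\<^sup>2 / h) \<le> \<bar>h\<bar>"
        by (auto simp: max_def power2_eq_square intro!: always_eventually)
    qed (auto intro!: tendsto_eq_intros)
    then show ?thesis using True by (simp add: DERIV_def)
  next
    case False
    show ?thesis
    proof (cases "r > 0")
      case True
      have "((\<lambda>r. r\<^sup>2) has_real_derivative 2 * max 0 r) (at r)"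
        using True by (auto intro!: derivative_eq_intros)
      moreover have "\<forall>\<^sub>F x in nhds r. x\<^sup>2 = (max 0 x)\<^sup>2"
        using eventually_nhds_in_open[of "{0<..}" r] True by (auto elim!: eventually_mono)
      ultimately show ?thesis by (subst DERIV_cong_ev[OF refl _ refl, symmetric]) auto
    next
      case neg: False
      have "((\<lambda>r. 0) has_real_derivative 2 * max 0 r) (at r)"
        using neg by (auto intro!: derivative_eq_intros)
      moreover have "\<forall>\<^sub>F x in nhds r. 0 = (max 0 x)\<^sup>2"
        using eventually_nhds_in_open[of "{..<0}" r] False neg by (auto elim!: eventually_mono)
      ultimately show ?thesis by (subst DERIV_cong_ev[OF refl _ refl, symmetric]) auto
    qed
  qed
qed (intro continuous_intros)

section \<open>Comparison of the two viscosity inequalities at a maximum\<close>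

lemma lipschitz_coefficient_component:
  fixes h :: "real \<times> (real ^ 'd) \<times> (real ^ 'm) \<Rightarrow> real ^ 'n"
  assumes lip: "L-lipschitz_on (coeff_dom T) h" and t: "t \<in> {0..T}" and s: "s \<in> {0..T}"
  shows "h (t, x, p) $ j \<le> h (s, y, q) $ j + L * (\<bar>t - s\<bar> + norm (x - y) + norm (p - q))"
proof -
  have "dist (h (t, x, p) $ j) (h (s, y, q) $ j) \<le> L * dist (t, x, p) (s, y, q)"
    using t s by (intro lipschitz_onD[OF component_lipschitz_on[OF lip]]) (auto simp: coeff_dom_def)
  also have "\<dots> \<le> L * (\<bar>t - s\<bar> + norm (x - y) + norm (p - q))"
    using lipschitz_on_nonneg[OF lip] norm_Pair_le[of "t - s" "(x - y, p - q)"]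
      norm_Pair_le[of "x - y" "p - q"]
    by (intro mult_left_mono) (auto simp: dist_norm)
  finally show ?thesis by (auto simp: dist_real_def)
qed

text \<open>
  The data after the preparations: pointwise monotonicity of the coefficients, and the viscosity
  inequalities in terms of \<open>u\<close> and \<open>v\<close> themselves, for global extrema. The lower bound on \<open>K\<close>
  collects the error terms: \<open>F\<close> from the gradient of the slack, \<open>L (2 + 2 |1|)\<close> from the oscillation
  of \<open>f\<close> and \<open>g\<close> between two points whose distance and gap are of the order of the slack.
  The assumption \<open>shift_limit\<close> is how the continuity of one of the two functions enters. It is
  symmetric in \<open>u\<close> and \<open>v\<close>, so that the two cases need not be distinguished below: if only \<open>u\<close> is
  continuous, the limit is taken along \<open>b = 0\<close>, otherwise along \<open>a = 0\<close>.
\<close>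

locale comparison_setting =
  fixes T F L B K :: real
    and f :: "real \<times> (real ^ 'd) \<times> (real ^ 'm) \<Rightarrow> real ^ 'd"
    and g :: "real \<times> (real ^ 'd) \<times> (real ^ 'm) \<Rightarrow> real ^ 'm"
    and u v :: "real \<times> (real ^ 'd) \<Rightarrow> real ^ 'm"
  assumes T_pos: "T > 0"
    and K_large: "1 + F + L * (2 + 2 * norm (1 :: real ^ 'm)) \<le> K"
    and f_bound: "\<And>t x p. t \<in> {0..T} \<Longrightarrow> norm (f (t, x, p)) \<le> F"
    and f_lip: "L-lipschitz_on (coeff_dom T) f"
    and g_lip: "L-lipschitz_on (coeff_dom T) g"
    and f_mono_x: "\<And>t x y p j. t \<in> {0..T} \<Longrightarrow> y \<le> x \<Longrightarrow> x $ j = y $ j \<Longrightarrow>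
      f (t, y, p) $ j \<le> f (t, x, p) $ j"
    and f_antimono_u: "\<And>t x p q j. t \<in> {0..T} \<Longrightarrow> q \<le> p \<Longrightarrow> f (t, x, p) $ j \<le> f (t, x, q) $ j"
    and g_antimono_x: "\<And>t x y p l. t \<in> {0..T} \<Longrightarrow> y \<le> x \<Longrightarrow> g (t, x, p) $ l \<le> g (t, y, p) $ l"
    and g_mono_u: "\<And>t x p q l. t \<in> {0..T} \<Longrightarrow> q \<le> p \<Longrightarrow> p $ l = q $ l \<Longrightarrow>
      g (t, x, q) $ l \<le> g (t, x, p) $ l"
    and u_bound: "\<And>t x k. t \<in> {0..T} \<Longrightarrow> \<bar>u (t, x) $ k\<bar> \<le> B"
    and v_bound: "\<And>t x k. t \<in> {0..T} \<Longrightarrow> \<bar>v (t, x) $ k\<bar> \<le> B"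
    and u_usc: "usc_on (time_space T) u"
    and v_lsc: "lsc_on (time_space T) v"
    and u_sub: "\<And>\<phi> \<phi>t \<phi>x i t x. C1_with_derivs T \<phi> \<phi>t \<phi>x \<Longrightarrow> t \<in> {0..<T} \<Longrightarrow>
      (\<And>t' x'. t' \<in> {0..T} \<Longrightarrow> u (t', x') $ i - \<phi> (t', x') \<le> u (t, x) $ i - \<phi> (t, x)) \<Longrightarrow>
      - \<phi>t (t, x) - f (t, x, u (t, x)) \<bullet> \<phi>x (t, x) - g (t, x, u (t, x)) $ i \<le> 0"
    and v_super: "\<And>\<phi> \<phi>t \<phi>x i t x. C1_with_derivs T \<phi> \<phi>t \<phi>x \<Longrightarrow> t \<in> {0..<T} \<Longrightarrow>
      (\<And>t' x'. t' \<in> {0..T} \<Longrightarrow> v (t, x) $ i - \<phi> (t, x) \<le> v (t', x') $ i - \<phi> (t', x')) \<Longrightarrow>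
      - \<phi>t (t, x) - f (t, x, v (t, x)) \<bullet> \<phi>x (t, x) - g (t, x, v (t, x)) $ i \<ge> 0"
    and terminal: "\<And>x y. y \<le> x \<Longrightarrow> u (T, x) \<le> v (T, y)"
    and shift_limit: "\<And>t x y k c. t \<in> {0..T} \<Longrightarrow>
      (\<And>a b. 0 \<le> a \<Longrightarrow> 0 \<le> b \<Longrightarrow> 0 < a + b \<Longrightarrow>
         u (t, x + a *\<^sub>R 1) $ k \<le> v (t, y - b *\<^sub>R 1) $ k + c + (a + b)) \<Longrightarrow>
      u (t, x) $ k \<le> v (t, y) $ k + c"
begin

text \<open>
  The slack \<open>\<omega>\<close>. Its logarithmic derivative in time is \<open>-K\<close>. The term with \<open>\<beta>\<close> makes it
  coercive, and since \<open>\<langle>x\<rangle> \<ge> 1\<close>, the gradients in \<open>x\<close> and \<open>y\<close> have norm at most half the slack.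
\<close>

definition slack :: "real \<Rightarrow> real \<Rightarrow> real \<Rightarrow> real ^ 'd \<Rightarrow> real ^ 'd \<Rightarrow> real" where
  "slack N \<beta> t x y = exp (K * (T - t)) * (N + \<beta> * (bracket x + bracket y))"

text \<open>
  As \<open>\<kappa>\<close> tends to \<open>0\<close>, maximising \<open>\<Phi>\<close> becomes maximising the gap minus the slack over \<open>t = s\<close> and
  \<open>x\<^sub>j \<ge> y\<^sub>j + \<omega>\<close>. The slack is evaluated at the time \<open>t\<close> of \<open>u\<close>, so that the test function for \<open>v\<close>
  depends on time through the penalty only.
\<close>

definition \<Phi> :: "real \<Rightarrow> real \<Rightarrow> real \<Rightarrow> 'm \<Rightarrow> real \<Rightarrow> real \<Rightarrow> real ^ 'd \<Rightarrow> real ^ 'd \<Rightarrow> real" where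
  "\<Phi> \<kappa> N \<beta> i t s x y = u (t, x) $ i - v (s, y) $ i - slack N \<beta> t x y
     - (\<Sum>j\<in>UNIV. (max 0 (slack N \<beta> t x y - x $ j + y $ j))\<^sup>2) / (2 * \<kappa>) - (t - s)\<^sup>2 / (2 * \<kappa>)"

lemma F_nonneg: "0 \<le> F"
  using f_bound[of 0 undefined undefined] T_pos norm_ge_zero order_trans by (metis atLeastAtMost_iff less_eq_real_def)

lemma L_nonneg: "0 \<le> L"
  using f_lip by (rule lipschitz_on_nonneg)

lemma C1_slack_first:
  "C1_with_derivs T (\<lambda>z. slack N \<beta> (fst z) (snd z) y) (\<lambda>z. - K * slack N \<beta> (fst z) (snd z) y)
     (\<lambda>z. (exp (K * (T - fst z)) * \<beta>) *\<^sub>R ((1 / bracket (snd z)) *\<^sub>R snd z))"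
proof -
  have "C1_with_derivs T (\<lambda>z::real \<times> (real ^ 'd). exp (K * (T - fst z))) (\<lambda>z. - K * exp (K * (T - fst z))) (\<lambda>z. 0)"
    by (rule C1_time) (auto intro!: derivative_eq_intros continuous_intros)
  moreover have "C1_with_derivs T (\<lambda>z. N + \<beta> * (bracket (snd z) + bracket y)) (\<lambda>z. 0 + \<beta> * (0 + 0))
      (\<lambda>z. 0 + \<beta> *\<^sub>R ((1 / bracket (snd z)) *\<^sub>R snd z + 0))"
    by (intro C1_add C1_const C1_cmult C1_bracket)
  ultimately show ?thesis
    by (rule C1_cong[OF C1_mult]) (simp_all add: slack_def)
qed

lemma C1_slack_second:
  "C1_with_derivs T (\<lambda>z. slack N \<beta> t x (snd z)) (\<lambda>z. 0)
     (\<lambda>z. (exp (K * (T - t)) * \<beta>) *\<^sub>R ((1 / bracket (snd z)) *\<^sub>R snd z))"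
proof -
  have "C1_with_derivs T (\<lambda>z. exp (K * (T - t)) * (N + \<beta> * (bracket x + bracket (snd z))))
      (\<lambda>z. exp (K * (T - t)) * (0 + \<beta> * (0 + 0)))
      (\<lambda>z. exp (K * (T - t)) *\<^sub>R (0 + \<beta> *\<^sub>R (0 + (1 / bracket (snd z)) *\<^sub>R snd z)))"
    by (intro C1_add C1_const C1_cmult C1_bracket)
  then show ?thesis
    by (rule C1_cong) (simp_all add: slack_def)
qed

lemma C1_square_time: "C1_with_derivs T (\<lambda>z. (fst z - s)\<^sup>2) (\<lambda>z. 2 * (fst z - s)) (\<lambda>z. 0)"
  by (rule C1_time) (auto intro!: derivative_eq_intros continuous_intros)

lemma f_lip_component:
  "t \<in> {0..T} \<Longrightarrow> s \<in> {0..T} \<Longrightarrow>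
     f (t, x, p) $ j \<le> f (s, y, q) $ j + L * (\<bar>t - s\<bar> + norm (x - y) + norm (p - q))"
  by (rule lipschitz_coefficient_component[OF f_lip])

lemma g_lip_component:
  "t \<in> {0..T} \<Longrightarrow> s \<in> {0..T} \<Longrightarrow>
     g (t, x, p) $ j \<le> g (s, y, q) $ j + L * (\<bar>t - s\<bar> + norm (x - y) + norm (p - q))"
  by (rule lipschitz_coefficient_component[OF g_lip])

text \<open>
  Only an upper bound for \<open>x\<^sub>j - y\<^sub>j\<close> in the one coordinate \<open>j\<close> is available; the other coordinates of
  \<open>x - y\<close> may be large. Hence \<open>x\<close> is first replaced by the point \<open>x'\<close> that agrees with \<open>x\<close> in the
  coordinate \<open>j\<close> and with \<open>y\<close> in the others. By quasimonotonicity this only lowers \<open>f\<^sup>j\<close>, and \<open>x'\<close> is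
  at distance at most \<open>\<omega>\<close> from \<open>y\<close>. Replacing \<open>p\<close> by the larger \<open>q + m 1\<close> lowers \<open>f\<^sup>j\<close> as well.
\<close>

lemma drift_gap:
  assumes t: "t \<in> {0..T}" and s: "s \<in> {0..T}" and yx: "y \<le> x" and xj: "x $ j - y $ j \<le> \<omega>"
    and ts: "\<bar>t - s\<bar> \<le> \<omega>" and m: "0 \<le> m" "m \<le> 2 * \<omega>" and pq: "p \<le> q + m *\<^sub>R 1"
  shows "f (s, y, q) $ j - f (t, x, p) $ j \<le> L * (2 + 2 * norm (1 :: real ^ 'm)) * \<omega>"
proof -
  define x' where "x' = y + (x $ j - y $ j) *\<^sub>R axis j 1"
  have x': "x' \<le> x" "x $ j = x' $ j"
    using yx by (auto simp: x'_def less_eq_vec_def axis_def)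
  have xy: "0 \<le> x $ j - y $ j" using yx by (simp add: less_eq_vec_def)
  have "f (s, y, q) $ j \<le> f (t, x', q + m *\<^sub>R 1) $ j
      + L * (\<bar>s - t\<bar> + norm (y - x') + norm (q - (q + m *\<^sub>R 1)))"
    by (rule f_lip_component[OF s t])
  also have "norm (y - x') = x $ j - y $ j" using xy by (simp add: x'_def)
  also have "norm (q - (q + m *\<^sub>R 1)) = m * norm (1 :: real ^ 'm)" using m by simp
  also have "f (t, x', q + m *\<^sub>R 1) $ j \<le> f (t, x, q + m *\<^sub>R 1) $ j"
    using f_mono_x[OF t x'] .
  also have "\<dots> \<le> f (t, x, p) $ j" using f_antimono_u[OF t pq] .
  finally have "f (s, y, q) $ j - f (t, x, p) $ j
      \<le> L * (\<bar>s - t\<bar> + (x $ j - y $ j) + m * norm (1 :: real ^ 'm))" by simp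
  also have "\<dots> \<le> L * (\<omega> + \<omega> + (2 * \<omega>) * norm (1 :: real ^ 'm))"
    using ts xj m L_nonneg by (intro mult_left_mono add_mono mult_right_mono) auto
  finally show ?thesis by (simp add: algebra_simps)
qed

text \<open>
  Since \<open>g\<close> is decreasing in the position, passing from \<open>x\<close> to \<open>y\<close> only raises \<open>g\<^sup>i\<close>. The equality in
  the component \<open>i\<close> allows the use of the quasimonotonicity of \<open>g\<^sup>i\<close> in the values.
\<close>

lemma source_gap:
  assumes t: "t \<in> {0..T}" and s: "s \<in> {0..T}" and yx: "y \<le> x"
    and ts: "\<bar>t - s\<bar> \<le> \<omega>" and m: "0 \<le> m" "m \<le> 2 * \<omega>"
    and pq: "p \<le> q + m *\<^sub>R 1" and pi: "p $ i = q $ i + m"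
  shows "g (t, x, p) $ i - g (s, y, q) $ i \<le> L * (2 + 2 * norm (1 :: real ^ 'm)) * \<omega>"
proof -
  have "g (t, x, p) $ i \<le> g (t, y, p) $ i" using g_antimono_x[OF t yx] .
  also have "\<dots> \<le> g (t, y, q + m *\<^sub>R 1) $ i" using pi by (intro g_mono_u[OF t pq]) simp
  also have "\<dots> \<le> g (s, y, q) $ i + L * (\<bar>t - s\<bar> + norm (y - y) + norm (q + m *\<^sub>R 1 - q))"
    by (rule g_lip_component[OF t s])
  also have "norm (q + m *\<^sub>R 1 - q) = m * norm (1 :: real ^ 'm)" using m by simp
  finally have "g (t, x, p) $ i - g (s, y, q) $ i \<le> L * (\<bar>t - s\<bar> + m * norm (1 :: real ^ 'm))" by simp
  also have "\<dots> \<le> L * (2 * \<omega> + (2 * \<omega>) * norm (1 :: real ^ 'm))"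
    using ts m L_nonneg by (intro mult_left_mono add_mono mult_right_mono) auto
  finally show ?thesis by (simp add: algebra_simps)
qed

lemma gradient_bound:
  assumes "t \<in> {0..T}" "0 \<le> c"
  shows "\<bar>f (t, x, p) \<bullet> (c *\<^sub>R ((1 / bracket z) *\<^sub>R z))\<bar> \<le> F * c"
proof -
  have "\<bar>f (t, x, p) \<bullet> (c *\<^sub>R ((1 / bracket z) *\<^sub>R z))\<bar>
      \<le> norm (f (t, x, p)) * norm (c *\<^sub>R ((1 / bracket z) *\<^sub>R z))"
    by (rule Cauchy_Schwarz_ineq2)
  also have "\<dots> \<le> F * (c * 1)"
    using norm_bracket_gradient_le[of z] f_bound[OF assms(1), of x p] F_nonneg assms(2)
    by (simp only: norm_scaleR[of c] abs_of_nonneg) (intro mult_mono mult_nonneg_nonneg; simp)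
  finally show ?thesis by simp
qed

lemma slack_pos: "0 \<le> N \<Longrightarrow> 0 < \<beta> \<Longrightarrow> 0 < slack N \<beta> t x y"
  using bracket_ge_1[of x] bracket_ge_1[of y] by (simp add: slack_def add_nonneg_pos)

text \<open>
  The heart of the proof. With \<open>q\<^sub>j\<close> the multipliers, \<open>Q\<close> their sum, and \<open>X\<close>, \<open>Y\<close> the spatial gradients
  of the slack \<open>\<omega>\<close>, the two viscosity inequalities have the momenta \<open>(1 + Q) X - q\<close> and
  \<open>- (1 + Q) Y - q\<close>. Their difference reads
  \<open>K \<omega> (1 + Q) \<le> (1 + Q) (f\<^sub>u \<bullet> X + f\<^sub>v \<bullet> Y) + \<Sum>\<^sub>j q\<^sub>j (f\<^sub>v\<^sup>j - f\<^sub>u\<^sup>j) + g\<^sub>u\<^sup>i - g\<^sub>v\<^sup>i\<close>, and by the lemmas above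
  the right-hand side is at most \<open>(1 + Q) (K - 1) \<omega>\<close>.
\<close>

lemma no_interior_maximum:
  assumes \<kappa>: "\<kappa> > 0" and \<beta>: "\<beta> > 0" and N: "N \<ge> 0"
    and t: "t \<in> {0..<T}" and s: "s \<in> {0..<T}"
    and max: "\<And>t' s' x' y'. t' \<in> {0..T} \<Longrightarrow> s' \<in> {0..T} \<Longrightarrow>
      \<Phi> \<kappa> N \<beta> i t' s' x' y' \<le> \<Phi> \<kappa> N \<beta> i t s x y"
    and ts: "\<bar>t - s\<bar> \<le> slack N \<beta> t x y" and yx: "y \<le> x"
    and m: "\<And>k. u (t, x) $ k - v (s, y) $ k \<le> u (t, x) $ i - v (s, y) $ i"
    and mW: "0 \<le> u (t, x) $ i - v (s, y) $ i" "u (t, x) $ i - v (s, y) $ i \<le> 2 * slack N \<beta> t x y"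
  shows False
proof -
  have t': "t \<in> {0..T}" and s': "s \<in> {0..T}" using t s by auto
  define \<omega> where "\<omega> = slack N \<beta> t x y"
  define q where "q j = max 0 (\<omega> - x $ j + y $ j) / \<kappa>" for j
  define Q where "Q = (\<Sum>j\<in>UNIV. q j)"
  define e where "e = exp (K * (T - t)) * \<beta>"
  define X where "X = e *\<^sub>R ((1 / bracket x) *\<^sub>R x)"
  define Y where "Y = e *\<^sub>R ((1 / bracket y) *\<^sub>R y)"
  define \<theta> where "\<theta> = (t - s) / \<kappa>"
  define fu where "fu = f (t, x, u (t, x))"
  define fv where "fv = f (s, y, v (s, y))"
  define A where "A = L * (2 + 2 * norm (1 :: real ^ 'm))"
  have \<omega>: "0 < \<omega>" unfolding \<omega>_def by (rule slack_pos[OF N \<beta>])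
  have q: "0 \<le> q j" for j using \<kappa> by (simp add: q_def)
  have Q: "0 \<le> Q" unfolding Q_def by (intro sum_nonneg q)
  have e: "0 < e" "2 * e \<le> \<omega>"
  proof -
    have "exp (K * (T - t)) * (0 + \<beta> * (1 + 1)) \<le> \<omega>"
      unfolding \<omega>_def slack_def using N \<beta> bracket_ge_1 by (intro mult_left_mono add_mono) auto
    then show "0 < e" "2 * e \<le> \<omega>" using \<beta> by (auto simp: e_def)
  qed
  have sub: "K * \<omega> * (1 + Q) - \<theta> - (1 + Q) * (fu \<bullet> X) + (\<Sum>j\<in>UNIV. q j * fu $ j)
      - g (t, x, u (t, x)) $ i \<le> 0"
  proof -
    let ?w = "\<lambda>z. slack N \<beta> (fst z) (snd z) y"
    let ?wx = "\<lambda>z. (exp (K * (T - fst z)) * \<beta>) *\<^sub>R ((1 / bracket (snd z)) *\<^sub>R snd z)"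
    let ?G = "\<lambda>j z. ?w z + ((- 1) * snd z $ j + y $ j)"
    let ?\<phi> = "\<lambda>z. (?w z + (\<Sum>j\<in>UNIV. (1 / (2 * \<kappa>)) * (max 0 (?G j z))\<^sup>2)) + (1 / (2 * \<kappa>)) * (fst z - s)\<^sup>2"
    have C1: "C1_with_derivs T ?\<phi>
       (\<lambda>z. (- K * ?w z + (\<Sum>j\<in>UNIV. (1 / (2 * \<kappa>)) * (2 * max 0 (?G j z) * (- K * ?w z + ((- 1) * 0 + 0)))))
             + (1 / (2 * \<kappa>)) * (2 * (fst z - s)))
       (\<lambda>z. (?wx z + (\<Sum>j\<in>UNIV. (1 / (2 * \<kappa>)) *\<^sub>R ((2 * max 0 (?G j z)) *\<^sub>R (?wx z + ((- 1) *\<^sub>R axis j 1 + 0)))))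
             + (1 / (2 * \<kappa>)) *\<^sub>R 0)"
      by (intro C1_add C1_sum C1_cmult C1_positive_part_squared C1_slack_first C1_coordinate C1_const
          C1_square_time finite)
    have le: "u (t', x') $ i - ?\<phi> (t', x') \<le> u (t, x) $ i - ?\<phi> (t, x)" if "t' \<in> {0..T}" for t' x'
      using max[OF that s', of x' y] by (simp add: \<Phi>_def sum_divide_distrib algebra_simps)
    have G: "max 0 (\<omega> + ((- 1) * x $ j + y $ j)) = \<kappa> * q j" for j
      using \<kappa> by (simp add: q_def)
    have phit: "- K * \<omega> + (\<Sum>j\<in>UNIV. (1 / (2 * \<kappa>)) * (2 * (\<kappa> * q j) * (- K * \<omega>)))
        = - (K * \<omega> * (1 + Q))"
      using \<kappa> by (simp add: Q_def sum_distrib_left sum_negf algebra_simps)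
    have phix: "fu \<bullet> (X + (\<Sum>j\<in>UNIV. (1 / (2 * \<kappa>)) *\<^sub>R ((2 * (\<kappa> * q j)) *\<^sub>R (X - axis j 1))))
        = (1 + Q) * (fu \<bullet> X) - (\<Sum>j\<in>UNIV. q j * fu $ j)"
      using \<kappa> by (simp add: Q_def inner_sum_right inner_diff_right inner_add_right inner_axis
          sum_distrib_right sum_subtractf algebra_simps)
    have time: "(1 / (2 * \<kappa>)) * (2 * (t - s)) = \<theta>"
      using \<kappa> by (simp add: \<theta>_def field_simps)
    show ?thesis
      using u_sub[OF C1 t le]
      unfolding fst_conv snd_conv \<omega>_def[symmetric] G fu_def[symmetric] e_def[symmetric]
        X_def[symmetric] scaleR_zero_right add_0_right mult_zero_right scaleR_minus1_left
        add_uminus_conv_diff phit phix time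
      by simp
  qed
  have super: "- \<theta> + (1 + Q) * (fv \<bullet> Y) + (\<Sum>j\<in>UNIV. q j * fv $ j)
      - g (s, y, v (s, y)) $ i \<ge> 0"
  proof -
    let ?w = "\<lambda>z. slack N \<beta> t x (snd z)"
    let ?wx = "\<lambda>z. (exp (K * (T - t)) * \<beta>) *\<^sub>R ((1 / bracket (snd z)) *\<^sub>R snd z)"
    let ?G = "\<lambda>j z. ?w z + (snd z $ j + - x $ j)"
    let ?\<phi> = "\<lambda>z. (- 1) * ((?w z + (\<Sum>j\<in>UNIV. (1 / (2 * \<kappa>)) * (max 0 (?G j z))\<^sup>2)) + (1 / (2 * \<kappa>)) * (fst z - t)\<^sup>2)"
    have C1: "C1_with_derivs T ?\<phi>
       (\<lambda>z. (- 1) * ((0 + (\<Sum>j\<in>UNIV. (1 / (2 * \<kappa>)) * (2 * max 0 (?G j z) * (0 + (0 + 0)))))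
             + (1 / (2 * \<kappa>)) * (2 * (fst z - t))))
       (\<lambda>z. (- 1) *\<^sub>R ((?wx z + (\<Sum>j\<in>UNIV. (1 / (2 * \<kappa>)) *\<^sub>R ((2 * max 0 (?G j z)) *\<^sub>R (?wx z + (axis j 1 + 0)))))
             + (1 / (2 * \<kappa>)) *\<^sub>R 0))"
      by (intro C1_add C1_sum C1_cmult C1_positive_part_squared C1_slack_second C1_coordinate C1_const
          C1_square_time finite)
    have le: "v (s, y) $ i - ?\<phi> (s, y) \<le> v (s', y') $ i - ?\<phi> (s', y')" if "s' \<in> {0..T}" for s' y'
      using max[OF t' that, of x y'] by (simp add: \<Phi>_def sum_divide_distrib algebra_simps power2_commute)
    have G: "max 0 (\<omega> + (y $ j + - x $ j)) = \<kappa> * q j" for j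
      using \<kappa> by (simp add: q_def algebra_simps)
    have phix: "fv \<bullet> (Y + (\<Sum>j\<in>UNIV. (1 / (2 * \<kappa>)) *\<^sub>R ((2 * (\<kappa> * q j)) *\<^sub>R (Y + axis j 1))))
        = (1 + Q) * (fv \<bullet> Y) + (\<Sum>j\<in>UNIV. q j * fv $ j)"
      using \<kappa> by (simp add: Q_def inner_sum_right inner_add_right inner_axis
          sum_distrib_right sum.distrib algebra_simps)
    have time: "(1 / (2 * \<kappa>)) * (2 * (s - t)) = - \<theta>"
      using \<kappa> by (simp add: \<theta>_def field_simps)
    show ?thesis
      using v_super[OF C1 s le]
      unfolding fst_conv snd_conv \<omega>_def[symmetric] G fv_def[symmetric] e_def[symmetric]
        Y_def[symmetric] scaleR_zero_right add_0_right add_0_left mult_zero_right sum.neutral_const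
        scaleR_minus1_left inner_minus_right phix time
      by simp
  qed
  have pq: "u (t, x) \<le> v (s, y) + (u (t, x) $ i - v (s, y) $ i) *\<^sub>R 1"
    unfolding less_eq_vec_def using m by (auto simp: algebra_simps)
  \<comment> \<open>A multiplier is nonzero only where its constraint is violated, that is where \<open>x\<^sub>j - y\<^sub>j < \<omega>\<close>.\<close>
  have drift: "q j * (fv $ j - fu $ j) \<le> q j * (A * \<omega>)" for j
  proof (cases "q j = 0")
    case False
    then have "x $ j - y $ j \<le> \<omega>" using \<kappa> by (auto simp: q_def max_def split: if_splits)
    then show ?thesis
      unfolding fu_def fv_def A_def using ts mW
      by (intro mult_left_mono q drift_gap[OF t' s' yx _ _ _ _ pq]) (auto simp: \<omega>_def)
  qed simp
  have "(\<Sum>j\<in>UNIV. q j * fv $ j) - (\<Sum>j\<in>UNIV. q j * fu $ j) = (\<Sum>j\<in>UNIV. q j * (fv $ j - fu $ j))"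
    by (simp add: sum_subtractf right_diff_distrib)
  also have "\<dots> \<le> (\<Sum>j\<in>UNIV. q j * (A * \<omega>))" by (intro sum_mono drift)
  also have "\<dots> = Q * (A * \<omega>)" by (simp add: Q_def sum_distrib_right)
  finally have drift_sum: "(\<Sum>j\<in>UNIV. q j * fv $ j) - (\<Sum>j\<in>UNIV. q j * fu $ j) \<le> Q * (A * \<omega>)" .
  have source: "g (t, x, u (t, x)) $ i - g (s, y, v (s, y)) $ i \<le> A * \<omega>"
    unfolding A_def using ts mW by (intro source_gap[OF t' s' yx _ _ _ pq]) (auto simp: \<omega>_def)
  have "fu \<bullet> X + fv \<bullet> Y \<le> 2 * (F * e)"
    using gradient_bound[OF t' less_imp_le[OF e(1)], of x "u (t, x)" x]
      gradient_bound[OF s' less_imp_le[OF e(1)], of y "v (s, y)" y]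
    unfolding fu_def fv_def X_def Y_def by linarith
  also have "\<dots> \<le> F * \<omega>" using mult_left_mono[OF e(2) F_nonneg] by simp
  finally have "(1 + Q) * (fu \<bullet> X + fv \<bullet> Y) \<le> (1 + Q) * (F * \<omega>)"
    using Q by (intro mult_left_mono) auto
  then have "K * \<omega> * (1 + Q) \<le> (1 + Q) * (F * \<omega>) + (1 + Q) * (A * \<omega>)"
    using sub super drift_sum source by (simp add: algebra_simps)
  then have "(1 + Q) * \<omega> * (K - F - A) \<le> 0" by (simp add: algebra_simps)
  moreover have "0 < (1 + Q) * \<omega> * (K - F - A)"
    using Q \<omega> K_large by (intro mult_pos_pos) (auto simp: A_def)
  ultimately show False by simp
qed

section \<open>The order between the graphs and the penalised maximum\<close>

text \<open>
  The order between the graphs that the equation propagates. The growth rate \<open>\<beta>\<close> stays fixed while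
  the level \<open>N\<close> is lowered to the smallest one for which the order holds at all times.
\<close>

definition slack_ordered :: "real \<Rightarrow> real \<Rightarrow> bool" where
  "slack_ordered N \<beta> \<longleftrightarrow> (\<forall>t\<in>{0..T}. \<forall>x y. (\<forall>j. y $ j + slack N \<beta> t x y \<le> x $ j) \<longrightarrow>
     (\<forall>k. u (t, x) $ k \<le> v (t, y) $ k + slack N \<beta> t x y))"

lemma K_nonneg: "0 \<le> K"
proof -
  have "0 \<le> L * (2 + 2 * norm (1 :: real ^ 'm))" using L_nonneg by (intro mult_nonneg_nonneg) auto
  then show ?thesis using K_large F_nonneg by linarith
qed

lemma exp_bounds:
  assumes "t \<in> {0..T}"
  shows "1 \<le> exp (K * (T - t))" "exp (K * (T - t)) \<le> exp (K * T)"
  using assms K_nonneg by (auto intro: mult_left_mono)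

lemma slack_mono: "N \<le> N' \<Longrightarrow> slack N \<beta> t x y \<le> slack N' \<beta> t x y"
  by (simp add: slack_def)

lemma slack_lower:
  assumes "t \<in> {0..T}" "0 \<le> N" "0 \<le> \<beta>"
  shows "N + \<beta> * (bracket x + bracket y) \<le> slack N \<beta> t x y"
proof -
  have "0 \<le> N + \<beta> * (bracket x + bracket y)"
    using assms bracket_ge_1[of x] bracket_ge_1[of y] by simp
  then show ?thesis
    using mult_right_mono[OF exp_bounds(1)[OF assms(1)], of "N + \<beta> * (bracket x + bracket y)"]
    by (simp add: slack_def)
qed

text \<open>
  Moving \<open>x\<close> up and \<open>y\<close> down along the diagonal by \<open>a + b\<close> in total gains \<open>a + b\<close> in every constraint.
  If \<open>\<beta>\<close> is small, half of that pays for the change of the brackets, and the other half for an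
  increase of \<open>N\<close>.
\<close>

lemma slack_shift:
  assumes t: "t \<in> {0..T}" and \<beta>: "0 \<le> \<beta>" and small: "exp (K * T) * \<beta> * norm (1 :: real ^ 'd) \<le> 1 / 2"
    and a: "0 \<le> a" and b: "0 \<le> b"
  shows "slack (N + (a + b) / (2 * exp (K * T))) \<beta> t (x + a *\<^sub>R 1) (y - b *\<^sub>R 1) \<le> slack N \<beta> t x y + (a + b)"
proof -
  let ?e = "exp (K * (T - t))"
  have br: "bracket (x + a *\<^sub>R 1) + bracket (y - b *\<^sub>R 1) \<le> bracket x + bracket y + (a + b) * norm (1 :: real ^ 'd)"
    using bracket_add_le[of x "a *\<^sub>R 1"] bracket_add_le[of y "- (b *\<^sub>R 1)"] a b by (simp add: algebra_simps)
  have "slack (N + (a + b) / (2 * exp (K * T))) \<beta> t (x + a *\<^sub>R 1) (y - b *\<^sub>R 1)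
      \<le> ?e * ((N + (a + b) / (2 * exp (K * T))) + \<beta> * (bracket x + bracket y + (a + b) * norm (1 :: real ^ 'd)))"
    unfolding slack_def using br \<beta> by (intro mult_left_mono add_left_mono) auto
  also have "\<dots> = slack N \<beta> t x y + ?e * ((a + b) / (2 * exp (K * T))) + ?e * (\<beta> * norm (1 :: real ^ 'd)) * (a + b)"
    by (simp add: slack_def algebra_simps)
  also have "?e * ((a + b) / (2 * exp (K * T))) \<le> exp (K * T) * ((a + b) / (2 * exp (K * T)))"
    using exp_bounds[OF t] a b by (intro mult_right_mono) auto
  also have "exp (K * T) * ((a + b) / (2 * exp (K * T))) = (a + b) / 2" by simp
  also have "?e * (\<beta> * norm (1 :: real ^ 'd)) * (a + b) \<le> exp (K * T) * (\<beta> * norm (1 :: real ^ 'd)) * (a + b)"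
    using exp_bounds[OF t] a b \<beta> by (intro mult_right_mono) auto
  also have "exp (K * T) * (\<beta> * norm (1 :: real ^ 'd)) * (a + b) \<le> 1 / 2 * (a + b)"
    using small a b by (intro mult_right_mono) (auto simp: mult.assoc)
  finally show ?thesis by simp
qed

lemma slack_ordered_mono:
  assumes "slack_ordered N \<beta>" "N \<le> N'"
  shows "slack_ordered N' \<beta>"
  unfolding slack_ordered_def
proof (intro ballI allI impI)
  fix t x y k assume t: "t \<in> {0..T}" and *: "\<forall>j. y $ j + slack N' \<beta> t x y \<le> x $ j"
  have W: "slack N \<beta> t x y \<le> slack N' \<beta> t x y" using slack_mono[OF assms(2)] .
  then have "\<forall>j. y $ j + slack N \<beta> t x y \<le> x $ j" using * by (meson add_left_mono order_trans)
  then have "u (t, x) $ k \<le> v (t, y) $ k + slack N \<beta> t x y" using assms(1) t by (auto simp: slack_ordered_def)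
  then show "u (t, x) $ k \<le> v (t, y) $ k + slack N' \<beta> t x y" using W by linarith
qed

lemma B_nonneg: "0 \<le> B"
proof -
  have "\<bar>u (0, 0) $ undefined\<bar> \<le> B" using T_pos by (intro u_bound) auto
  then show ?thesis by linarith
qed

lemma slack_ordered_large:
  assumes "0 \<le> \<beta>"
  shows "slack_ordered (2 * B) \<beta>"
  unfolding slack_ordered_def
proof (intro ballI allI impI)
  fix t k and x y :: "real ^ 'd" assume t: "t \<in> {0..T}"
  have "0 \<le> \<beta> * (bracket x + bracket y)"
    using assms bracket_ge_1[of x] bracket_ge_1[of y] by simp
  then have "2 * B \<le> slack (2 * B) \<beta> t x y" using slack_lower[OF t _ assms, of "2 * B" x y] B_nonneg by simp
  then show "u (t, x) $ k \<le> v (t, y) $ k + slack (2 * B) \<beta> t x y"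
    using u_bound[OF t, of x k] v_bound[OF t, of y k] by linarith
qed

text \<open>
  A pair of points that is admissible for \<open>N\<close> becomes admissible for a larger \<open>N'\<close> after a small diagonal
  shift, and \<open>shift_limit\<close> removes the shift.
\<close>

lemma slack_ordered_closed:
  assumes \<beta>: "0 \<le> \<beta>" and small: "exp (K * T) * \<beta> * norm (1 :: real ^ 'd) \<le> 1 / 2"
    and above: "\<And>N'. N < N' \<Longrightarrow> slack_ordered N' \<beta>"
  shows "slack_ordered N \<beta>"
  unfolding slack_ordered_def
proof (intro ballI allI impI)
  fix t x y k assume t: "t \<in> {0..T}" and *: "\<forall>j. y $ j + slack N \<beta> t x y \<le> x $ j"
  show "u (t, x) $ k \<le> v (t, y) $ k + slack N \<beta> t x y"
  proof (rule shift_limit[OF t])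
    fix a b :: real assume ab: "0 \<le> a" "0 \<le> b" "0 < a + b"
    let ?W = "slack (N + (a + b) / (2 * exp (K * T))) \<beta> t (x + a *\<^sub>R 1) (y - b *\<^sub>R 1)"
    have W: "?W \<le> slack N \<beta> t x y + (a + b)" by (rule slack_shift[OF t \<beta> small ab(1,2)])
    have "(y - b *\<^sub>R 1) $ j + ?W \<le> (x + a *\<^sub>R 1) $ j" for j
      using W *[rule_format, of j] by simp
    moreover have "slack_ordered (N + (a + b) / (2 * exp (K * T))) \<beta>"
      using ab by (intro above) simp
    ultimately have "u (t, x + a *\<^sub>R 1) $ k \<le> v (t, y - b *\<^sub>R 1) $ k + ?W"
      using t unfolding slack_ordered_def by blast
    then show "u (t, x + a *\<^sub>R 1) $ k \<le> v (t, y - b *\<^sub>R 1) $ k + slack N \<beta> t x y + (a + b)"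
      using W by linarith
  qed
qed

lemma tendsto_slack:
  assumes "(N \<longlongrightarrow> N') G" "(t \<longlongrightarrow> t') G" "(x \<longlongrightarrow> x') G" "(y \<longlongrightarrow> y') G"
  shows "((\<lambda>n. slack (N n) \<beta> (t n) (x n) (y n)) \<longlongrightarrow> slack N' \<beta> t' x' y') G"
  unfolding slack_def bracket_def by (intro tendsto_intros assms)

text \<open>
  The gap is at most \<open>2 B\<close>, and it dominates the slack and both penalties. The bounds on the
  norms supply compactness, the bounds on the penalties force the constraints as \<open>\<kappa>\<close> tends to \<open>0\<close>.
\<close>

lemma \<Phi>_pos_imp:
  assumes \<kappa>: "\<kappa> > 0" and \<beta>: "\<beta> > 0" and N: "N \<ge> 0" and t: "t \<in> {0..T}" and s: "s \<in> {0..T}"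
    and pos: "\<Phi> \<kappa> N \<beta> i t s x y > 0"
  shows "norm x \<le> 2 * B / \<beta>" "norm y \<le> 2 * B / \<beta>"
    and "slack N \<beta> t x y < u (t, x) $ i - v (s, y) $ i"
    and "(t - s)\<^sup>2 \<le> 4 * B * \<kappa>"
    and "(max 0 (slack N \<beta> t x y - x $ j + y $ j))\<^sup>2 \<le> 4 * B * \<kappa>"
proof -
  define S where "S = (\<Sum>j\<in>UNIV. (max 0 (slack N \<beta> t x y - x $ j + y $ j))\<^sup>2)"
  have S: "(max 0 (slack N \<beta> t x y - x $ j + y $ j))\<^sup>2 \<le> S" for j
    unfolding S_def by (intro member_le_sum) auto
  then have "0 \<le> S" by (meson order_trans zero_le_power2)
  then have pen: "0 \<le> S / (2 * \<kappa>)" "0 \<le> (t - s)\<^sup>2 / (2 * \<kappa>)" using \<kappa> by auto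
  have gap: "u (t, x) $ i - v (s, y) $ i \<le> 2 * B"
    using u_bound[OF t, of x i] v_bound[OF s, of y i] by linarith
  have pos': "0 < u (t, x) $ i - v (s, y) $ i - slack N \<beta> t x y - S / (2 * \<kappa>) - (t - s)\<^sup>2 / (2 * \<kappa>)"
    using pos by (simp add: \<Phi>_def S_def)
  show "slack N \<beta> t x y < u (t, x) $ i - v (s, y) $ i" using pos' pen by linarith
  have W: "\<beta> * (bracket x + bracket y) \<le> slack N \<beta> t x y" "0 < slack N \<beta> t x y"
    using slack_lower[OF t N, of \<beta> x y] \<beta> N slack_pos[OF N \<beta>] by auto
  have "\<beta> * (bracket x + bracket y) \<le> 2 * B" using W pos' pen gap by linarith
  then have "bracket x + bracket y \<le> 2 * B / \<beta>" using \<beta> by (simp add: field_simps)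
  then show "norm x \<le> 2 * B / \<beta>" "norm y \<le> 2 * B / \<beta>"
    using norm_le_bracket[of x] norm_le_bracket[of y] bracket_ge_1[of x] bracket_ge_1[of y] by linarith+
  have "(t - s)\<^sup>2 / (2 * \<kappa>) \<le> 2 * B" using pos' pen W gap by linarith
  then show "(t - s)\<^sup>2 \<le> 4 * B * \<kappa>" using \<kappa> by (simp add: field_simps)
  have "S / (2 * \<kappa>) \<le> 2 * B" using pos' pen W gap by linarith
  then have "S \<le> 4 * B * \<kappa>" using \<kappa> by (simp add: field_simps)
  then show "(max 0 (slack N \<beta> t x y - x $ j + y $ j))\<^sup>2 \<le> 4 * B * \<kappa>" using S order_trans by blast
qed

lemma u_usc_sequence:
  assumes "\<And>n. t n \<in> {0..T}" "t \<longlonglongrightarrow> t'" "t' \<in> {0..T}" "x \<longlonglongrightarrow> x'" "\<epsilon> > 0"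
  shows "\<forall>\<^sub>F n in sequentially. u (t n, x n) $ k < u (t', x') $ k + \<epsilon>"
  using assms by (intro usc_on_sequence[OF u_usc]) (auto simp: time_space_def intro: tendsto_Pair)

lemma v_lsc_sequence:
  assumes "\<And>n. t n \<in> {0..T}" "t \<longlonglongrightarrow> t'" "t' \<in> {0..T}" "x \<longlonglongrightarrow> x'" "\<epsilon> > 0"
  shows "\<forall>\<^sub>F n in sequentially. v (t', x') $ k - \<epsilon> < v (t n, x n) $ k"
  using assms by (intro lsc_on_sequence[OF v_lsc]) (auto simp: time_space_def intro: tendsto_Pair)

lemma \<Phi>_usc_sequence:
  assumes t: "\<And>n. t n \<in> {0..T}" "t \<longlonglongrightarrow> t'" "t' \<in> {0..T}"
    and s: "\<And>n. s n \<in> {0..T}" "s \<longlonglongrightarrow> s'" "s' \<in> {0..T}"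
    and x: "x \<longlonglongrightarrow> x'" and y: "y \<longlonglongrightarrow> y'" and \<kappa>: "\<kappa> > 0" and \<epsilon>: "\<epsilon> > 0"
  shows "\<forall>\<^sub>F n in sequentially. \<Phi> \<kappa> N \<beta> k (t n) (s n) (x n) (y n) < \<Phi> \<kappa> N \<beta> k t' s' x' y' + \<epsilon>"
proof -
  define C where "C t s x y = slack N \<beta> t x y + (\<Sum>j\<in>UNIV. (max 0 (slack N \<beta> t x y - x $ j + y $ j))\<^sup>2) / (2 * \<kappa>)
      + (t - s)\<^sup>2 / (2 * \<kappa>)" for t s x y
  have "(\<lambda>n. C (t n) (s n) (x n) (y n)) \<longlonglongrightarrow> C t' s' x' y'"
    unfolding C_def using \<kappa> by (intro tendsto_intros tendsto_slack t s x y) auto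
  then have "\<forall>\<^sub>F n in sequentially. C t' s' x' y' - \<epsilon> / 3 < C (t n) (s n) (x n) (y n)"
    using \<epsilon> by (intro order_tendstoD(1)) auto
  moreover have "\<forall>\<^sub>F n in sequentially. u (t n, x n) $ k < u (t', x') $ k + \<epsilon> / 3"
    using \<epsilon> by (intro u_usc_sequence t x) auto
  moreover have "\<forall>\<^sub>F n in sequentially. v (s', y') $ k - \<epsilon> / 3 < v (s n, y n) $ k"
    using \<epsilon> by (intro v_lsc_sequence s y) auto
  ultimately show ?thesis
  proof eventually_elim
    case (elim n)
    have "\<Phi> \<kappa> N \<beta> k t s x y = u (t, x) $ k - v (s, y) $ k - C t s x y" for t s x y
      by (simp add: \<Phi>_def C_def)
    then show ?case using elim by simp
  qed
qed

text \<open>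
  The maximum is taken over the components too: comparing components at the maximal point shows that
  \<open>i\<close> has the largest gap, which \<open>no_interior_maximum\<close> asks for. A positive value of \<open>\<Phi>\<close> is
  needed to confine the problem to a compact set.
\<close>

lemma \<Phi>_attains_max:
  assumes \<kappa>: "\<kappa> > 0" and \<beta>: "\<beta> > 0" and N: "N \<ge> 0" and t0: "t0 \<in> {0..T}" and s0: "s0 \<in> {0..T}"
    and pos: "\<Phi> \<kappa> N \<beta> k0 t0 s0 x0 y0 > 0"
  shows "\<exists>i. \<exists>t\<in>{0..T}. \<exists>s\<in>{0..T}. \<exists>x y. \<forall>k. \<forall>t'\<in>{0..T}. \<forall>s'\<in>{0..T}. \<forall>x' y'.
    \<Phi> \<kappa> N \<beta> k t' s' x' y' \<le> \<Phi> \<kappa> N \<beta> i t s x y"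
proof -
  define C where "C = {0..T} \<times> {0..T} \<times> cball (0 :: real ^ 'd) (2 * B / \<beta>) \<times> cball (0 :: real ^ 'd) (2 * B / \<beta>)"
  define P where "P k = (\<lambda>(t, s, x, y). \<Phi> \<kappa> N \<beta> k t s x y)" for k
  have inC: "(t, s, x, y) \<in> C" if "\<Phi> \<kappa> N \<beta> k t s x y > 0" "t \<in> {0..T}" "s \<in> {0..T}" for k t s x y
    using \<Phi>_pos_imp(1,2)[OF \<kappa> \<beta> N that(2,3,1)] that by (auto simp: C_def)
  have "\<exists>z\<in>C. \<forall>z'\<in>C. P k z' \<le> P k z" for k
  proof (rule compact_usc_attains_sup)
    show "compact C" unfolding C_def by (intro compact_Times compact_cball compact_Icc)
    show "C \<noteq> {}" using inC[OF pos t0 s0] by auto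
    show "bdd_above (P k ` C)"
    proof (rule bdd_aboveI2)
      fix z assume z: "z \<in> C"
      obtain t s x y where zz: "z = (t, s, x, y)" by (cases z)
      show "P k z \<le> 2 * B"
      proof (cases "\<Phi> \<kappa> N \<beta> k t s x y > 0")
        case True
        have ts: "t \<in> {0..T}" "s \<in> {0..T}" using z by (auto simp: zz C_def)
        have "\<Phi> \<kappa> N \<beta> k t s x y \<le> u (t, x) $ k - v (s, y) $ k"
        proof -
          have "0 \<le> (\<Sum>j\<in>UNIV. (max 0 (slack N \<beta> t x y - x $ j + y $ j))\<^sup>2) / (2 * \<kappa>)" "0 \<le> (t - s)\<^sup>2 / (2 * \<kappa>)"
            using \<kappa> by (auto intro!: divide_nonneg_nonneg sum_nonneg)
          then show ?thesis using slack_pos[OF N \<beta>, of t x y] unfolding \<Phi>_def by linarith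
        qed
        then show ?thesis
          using u_bound[OF ts(1), of x k] v_bound[OF ts(2), of y k] by (simp add: zz P_def)
      next
        case False
        then show ?thesis using B_nonneg by (simp add: zz P_def)
      qed
    qed
    fix a z and \<epsilon> :: real
    assume a: "\<And>n. a n \<in> C" and z: "z \<in> C" and lim: "a \<longlonglongrightarrow> z" and \<epsilon>: "\<epsilon> > 0"
    obtain t s x y where zz: "z = (t, s, x, y)" by (cases z)
    have an: "P k (a n) = \<Phi> \<kappa> N \<beta> k (fst (a n)) (fst (snd (a n))) (fst (snd (snd (a n)))) (snd (snd (snd (a n))))" for n
      by (simp add: P_def case_prod_unfold)
    have "(\<lambda>n. fst (a n)) \<longlonglongrightarrow> t" "(\<lambda>n. fst (snd (a n))) \<longlonglongrightarrow> s"
      "(\<lambda>n. fst (snd (snd (a n)))) \<longlonglongrightarrow> x" "(\<lambda>n. snd (snd (snd (a n)))) \<longlonglongrightarrow> y"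
      using tendsto_fst[OF lim] tendsto_fst[OF tendsto_snd[OF lim]]
        tendsto_fst[OF tendsto_snd[OF tendsto_snd[OF lim]]] tendsto_snd[OF tendsto_snd[OF tendsto_snd[OF lim]]]
      by (simp_all add: zz)
    moreover have "fst (a n) \<in> {0..T}" "fst (snd (a n)) \<in> {0..T}" for n
      using a[of n] by (auto simp: C_def)
    moreover have "t \<in> {0..T}" "s \<in> {0..T}" using z by (auto simp: zz C_def)
    ultimately show "\<forall>\<^sub>F n in sequentially. P k (a n) < P k z + \<epsilon>"
      unfolding an using \<Phi>_usc_sequence[OF _ _ _ _ _ _ _ _ \<kappa> \<epsilon>] by (simp add: zz P_def)
  qed
  then obtain Z where Z: "\<And>k. Z k \<in> C" "\<And>k z'. z' \<in> C \<Longrightarrow> P k z' \<le> P k (Z k)" by metis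
  obtain i where i: "\<And>k. P k (Z k) \<le> P i (Z i)"
  proof -
    have "Max (range (\<lambda>k. P k (Z k))) \<in> range (\<lambda>k. P k (Z k))" by (intro Max_in) auto
    then obtain i where "Max (range (\<lambda>k. P k (Z k))) = P i (Z i)" by (rule imageE)
    then show ?thesis using that[of i] Max_ge[of "range (\<lambda>k. P k (Z k))"] by auto
  qed
  obtain t s x y where Zi: "Z i = (t, s, x, y)" by (cases "Z i")
  have le: "P k z' \<le> P i (Z i)" if "z' \<in> C" for k z' using Z(2)[OF that] i order_trans by blast
  have "0 < \<Phi> \<kappa> N \<beta> i t s x y"
    using le[OF inC[OF pos t0 s0], of k0] pos by (simp add: P_def Zi)
  then have "\<Phi> \<kappa> N \<beta> k t' s' x' y' \<le> \<Phi> \<kappa> N \<beta> i t s x y" if "t' \<in> {0..T}" "s' \<in> {0..T}" for k t' s' x' y'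
    using le[OF inC[OF _ that], of k x' y' k] that by (cases "\<Phi> \<kappa> N \<beta> k t' s' x' y' > 0") (auto simp: P_def Zi)
  moreover have "t \<in> {0..T}" "s \<in> {0..T}" using Z(1)[of i] by (auto simp: Zi C_def)
  ultimately show ?thesis by blast
qed

section \<open>Propagation of the order between the graphs\<close>

text \<open>
  At a critical level \<open>M\<close> the order holds but fails for all smaller levels, so the penalised maxima
  for levels \<open>N\<^sub>n\<close> increasing to \<open>M\<close> and penalties \<open>\<kappa>\<^sub>n\<close> decreasing to \<open>0\<close> are positive. Their maximisers
  accumulate at a pair of points that is admissible for \<open>M\<close>, where the gap is therefore at most the
  slack. By semicontinuity the gap is at most twice the slack along the sequence, and eventually
  all hypotheses of \<open>no_interior_maximum\<close> hold. The terminal condition keeps the limit away from \<open>T\<close>.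
\<close>

lemma slack_level_not_critical:
  assumes \<beta>: "\<beta> > 0" and M: "M > 0" and ord: "slack_ordered M \<beta>"
    and fails: "\<And>N. 0 \<le> N \<Longrightarrow> N < M \<Longrightarrow> \<not> slack_ordered N \<beta>"
  shows False
proof -
  define N where "N n = M - M * inverse (real (Suc n))" for n :: nat
  define \<kappa> where "\<kappa> n = inverse (real (Suc n))" for n :: nat
  have \<kappa>: "\<kappa> n > 0" for n by (simp add: \<kappa>_def)
  have N: "0 \<le> N n" "N n < M" for n
    using M by (simp_all add: N_def field_simps)
  define is_max where "is_max n i t s x y \<longleftrightarrow>
      t \<in> {0..T} \<and> s \<in> {0..T} \<and> 0 < \<Phi> (\<kappa> n) (N n) \<beta> i t s x y \<and>
      (\<forall>k. \<forall>t'\<in>{0..T}. \<forall>s'\<in>{0..T}. \<forall>x' y'.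
        \<Phi> (\<kappa> n) (N n) \<beta> k t' s' x' y' \<le> \<Phi> (\<kappa> n) (N n) \<beta> i t s x y)" for n i t s x y
  have "\<exists>i t s x y. is_max n i t s x y" for n
  proof -
    obtain t x y k where t: "t \<in> {0..T}" and region: "\<And>j. y $ j + slack (N n) \<beta> t x y \<le> x $ j"
      and viol: "\<not> u (t, x) $ k \<le> v (t, y) $ k + slack (N n) \<beta> t x y"
      using fails[OF N, of n] unfolding slack_ordered_def by blast
    have "max 0 (slack (N n) \<beta> t x y - x $ j + y $ j) = 0" for j
      using region[of j] by simp
    then have pos: "0 < \<Phi> (\<kappa> n) (N n) \<beta> k t t x y"
      using viol by (simp add: \<Phi>_def)
    obtain i' t' s' x' y' where max: "t' \<in> {0..T}" "s' \<in> {0..T}"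
      "\<forall>k. \<forall>t''\<in>{0..T}. \<forall>s''\<in>{0..T}. \<forall>x'' y''.
        \<Phi> (\<kappa> n) (N n) \<beta> k t'' s'' x'' y'' \<le> \<Phi> (\<kappa> n) (N n) \<beta> i' t' s' x' y'"
      using \<Phi>_attains_max[OF \<kappa> \<beta> N(1) t t pos] by blast
    moreover have "0 < \<Phi> (\<kappa> n) (N n) \<beta> i' t' s' x' y'"
      using max(3) t pos less_le_trans by blast
    ultimately have "is_max n i' t' s' x' y'" unfolding is_max_def by blast
    then show ?thesis by blast
  qed
  then obtain i t s x y where "\<And>n. is_max n (i n) (t n) (s n) (x n) (y n)" by metis
  then have t: "\<And>n. t n \<in> {0..T}" and s: "\<And>n. s n \<in> {0..T}"
    and pos: "\<And>n. 0 < \<Phi> (\<kappa> n) (N n) \<beta> (i n) (t n) (s n) (x n) (y n)"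
    and max: "\<And>n k t' s' x' y'. t' \<in> {0..T} \<Longrightarrow> s' \<in> {0..T} \<Longrightarrow>
        \<Phi> (\<kappa> n) (N n) \<beta> k t' s' x' y' \<le> \<Phi> (\<kappa> n) (N n) \<beta> (i n) (t n) (s n) (x n) (y n)"
    unfolding is_max_def by blast+
  note props = \<Phi>_pos_imp[OF \<kappa> \<beta> N(1) t s pos]
  define C where "C = {0..T} \<times> {0..T} \<times> cball (0 :: real ^ 'd) (2 * B / \<beta>) \<times> cball (0 :: real ^ 'd) (2 * B / \<beta>)"
  have "seq_compact C"
    unfolding C_def by (intro compact_imp_seq_compact compact_Times compact_cball compact_Icc)
  moreover have inC: "\<forall>n. (t n, s n, x n, y n) \<in> C"
    using t s props(1,2) by (auto simp: C_def)
  ultimately obtain z r where z: "z \<in> C" "strict_mono r" "((\<lambda>n. (t n, s n, x n, y n)) \<circ> r) \<longlonglongrightarrow> z"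
    by (rule seq_compactE)
  obtain t0 s0 x0 y0 where zz: "z = (t0, s0, x0, y0)" by (cases z)
  have t0: "t0 \<in> {0..T}" using z(1) by (auto simp: zz C_def)
  have lim: "(\<lambda>n. (t (r n), s (r n), x (r n), y (r n))) \<longlonglongrightarrow> (t0, s0, x0, y0)"
    using z(3) by (simp add: o_def zz)
  have tl: "(\<lambda>n. t (r n)) \<longlonglongrightarrow> t0" and sl: "(\<lambda>n. s (r n)) \<longlonglongrightarrow> s0"
    and xl: "(\<lambda>n. x (r n)) \<longlonglongrightarrow> x0" and yl: "(\<lambda>n. y (r n)) \<longlonglongrightarrow> y0"
    using tendsto_fst[OF lim] tendsto_fst[OF tendsto_snd[OF lim]]
      tendsto_fst[OF tendsto_snd[OF tendsto_snd[OF lim]]] tendsto_snd[OF tendsto_snd[OF tendsto_snd[OF lim]]]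
    by simp_all
  have N_lim: "(\<lambda>n. N (r n)) \<longlonglongrightarrow> M"
  proof -
    have "N \<longlonglongrightarrow> M - M * 0"
      unfolding N_def by (intro tendsto_intros LIMSEQ_inverse_real_of_nat)
    then show ?thesis using LIMSEQ_subseq_LIMSEQ[OF _ z(2)] by (simp add: o_def)
  qed
  have pen_lim: "(\<lambda>n. 4 * B * \<kappa> (r n)) \<longlonglongrightarrow> 0"
  proof -
    have "(\<lambda>n. 4 * B * \<kappa> n) \<longlonglongrightarrow> 4 * B * 0"
      unfolding \<kappa>_def by (intro tendsto_intros LIMSEQ_inverse_real_of_nat)
    then show ?thesis using LIMSEQ_subseq_LIMSEQ[OF _ z(2)] by (simp add: o_def)
  qed
  define \<omega> where "\<omega> = slack M \<beta> t0 x0 y0"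
  have \<omega>: "0 < \<omega>" unfolding \<omega>_def using slack_pos[of M \<beta>] M \<beta> by simp
  have Wl: "(\<lambda>n. slack (N (r n)) \<beta> (t (r n)) (x (r n)) (y (r n))) \<longlonglongrightarrow> \<omega>"
    unfolding \<omega>_def by (intro tendsto_slack N_lim tl xl yl)
  have "(t0 - s0)\<^sup>2 \<le> 0"
    by (rule LIMSEQ_le[OF tendsto_power[OF tendsto_diff[OF tl sl]] pen_lim]) (use props(4) in blast)
  then have s0: "s0 = t0" by simp
  have region: "y0 $ j + \<omega> \<le> x0 $ j" for j
  proof -
    have "(\<lambda>n. (max 0 (slack (N (r n)) \<beta> (t (r n)) (x (r n)) (y (r n)) - x (r n) $ j + y (r n) $ j))\<^sup>2)
        \<longlonglongrightarrow> (max 0 (\<omega> - x0 $ j + y0 $ j))\<^sup>2"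
      by (intro tendsto_intros Wl xl yl)
    then have "(max 0 (\<omega> - x0 $ j + y0 $ j))\<^sup>2 \<le> 0"
      by (rule LIMSEQ_le[OF _ pen_lim]) (use props(5) in blast)
    then show ?thesis by (simp add: max_def split: if_splits)
  qed
  have yx0: "y0 \<le> x0"
    unfolding less_eq_vec_def
  proof
    show "y0 $ j \<le> x0 $ j" for j using region[of j] \<omega> by linarith
  qed
  have contact: "u (t0, x0) $ k \<le> v (t0, y0) $ k + \<omega>" for k
    using ord t0 region unfolding slack_ordered_def \<omega>_def by blast
  \<comment> \<open>Any fixed small fraction of the limiting slack would do; with \<open>1/8\<close> the gap is at most
    \<open>10 \<epsilon>\<close> and the slack at least \<open>7 \<epsilon>\<close> along the sequence.\<close>
  define \<epsilon> where "\<epsilon> = \<omega> / 8"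
  have \<epsilon>: "\<epsilon> > 0" using \<omega> by (simp add: \<epsilon>_def)
  have ev_u: "\<forall>\<^sub>F n in sequentially. \<forall>k. u (t (r n), x (r n)) $ k < u (t0, x0) $ k + \<epsilon>"
    by (intro eventually_all_finite u_usc_sequence t tl t0 xl \<epsilon>)
  have ev_v: "\<forall>\<^sub>F n in sequentially. \<forall>k. v (t0, y0) $ k - \<epsilon> < v (s (r n), y (r n)) $ k"
    using sl unfolding s0 by (intro eventually_all_finite v_lsc_sequence s t0 yl \<epsilon>)
  have ev_W: "\<forall>\<^sub>F n in sequentially. \<omega> - \<epsilon> < slack (N (r n)) \<beta> (t (r n)) (x (r n)) (y (r n))"
    using \<epsilon> by (intro order_tendstoD(1)[OF Wl]) simp
  have "t0 < T"
  proof (rule ccontr)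
    assume "\<not> t0 < T"
    then have "t0 = T" using t0 by simp
    then have le: "u (t0, x0) $ k \<le> v (t0, y0) $ k" for k
      using terminal[OF yx0] by (simp add: less_eq_vec_def)
    \<comment> \<open>At time \<open>T\<close> no positive gap is possible in the limit, but the gap exceeds the slack.\<close>
    have "\<forall>\<^sub>F n in sequentially. False"
      using ev_u ev_v ev_W
    proof eventually_elim
      case (elim n)
      then show False
        using elim(1)[rule_format, of "i (r n)"] elim(2)[rule_format, of "i (r n)"]
          props(3)[of "r n"] le[of "i (r n)"] \<omega> unfolding \<epsilon>_def by linarith
    qed
    then show False by simp
  qed
  then have ev_T: "\<forall>\<^sub>F n in sequentially. t (r n) < T" "\<forall>\<^sub>F n in sequentially. s (r n) < T"
    using order_tendstoD(2)[OF tl] order_tendstoD(2)[OF sl] s0 by auto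
  have "(\<lambda>n. \<bar>t (r n) - s (r n)\<bar>) \<longlonglongrightarrow> \<bar>t0 - s0\<bar>" by (intro tendsto_intros tl sl)
  then have ev_ts: "\<forall>\<^sub>F n in sequentially. \<bar>t (r n) - s (r n)\<bar> < \<epsilon>"
    using \<epsilon> s0 by (intro order_tendstoD(2)) auto
  have "\<forall>\<^sub>F n in sequentially. \<forall>j. 0 < x (r n) $ j - y (r n) $ j"
  proof (rule eventually_all_finite)
    fix j
    have "(\<lambda>n. x (r n) $ j - y (r n) $ j) \<longlonglongrightarrow> x0 $ j - y0 $ j" by (intro tendsto_intros xl yl)
    then show "\<forall>\<^sub>F n in sequentially. 0 < x (r n) $ j - y (r n) $ j"
      by (rule order_tendstoD(1)) (use region[of j] \<omega> in linarith)
  qed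
  with ev_u ev_v ev_W ev_T ev_ts have "\<forall>\<^sub>F n in sequentially. False"
  proof eventually_elim
    case (elim n)
    let ?n = "r n"
    let ?m = "u (t ?n, x ?n) $ i ?n - v (s ?n, y ?n) $ i ?n"
    let ?W = "slack (N ?n) \<beta> (t ?n) (x ?n) (y ?n)"
    have W: "7 * \<epsilon> < ?W" using elim(3) by (simp add: \<epsilon>_def)
    have "?m \<le> \<omega> + 2 * \<epsilon>"
      using elim(1)[rule_format, of "i ?n"] elim(2)[rule_format, of "i ?n"] contact[of "i ?n"] by linarith
    then have m2: "?m \<le> 2 * ?W" using W \<epsilon> by (simp add: \<epsilon>_def)
    have m1: "0 \<le> ?m" using props(3)[of ?n] W \<epsilon> by linarith
    have mk: "u (t ?n, x ?n) $ k - v (s ?n, y ?n) $ k \<le> ?m" for k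
      using max[OF t s, of ?n k ?n ?n "x ?n" "y ?n"] by (simp add: \<Phi>_def)
    have yx: "y ?n \<le> x ?n" using elim(7) by (simp add: less_eq_vec_def less_imp_le)
    have ts: "\<bar>t ?n - s ?n\<bar> \<le> ?W" using elim(6) W \<epsilon> by linarith
    have tT: "t ?n \<in> {0..<T}" "s ?n \<in> {0..<T}" using elim(4,5) t[of ?n] s[of ?n] by auto
    show False
      by (rule no_interior_maximum[OF \<kappa> \<beta> N(1) tT max ts yx mk m1 m2])
  qed
  then show False by simp
qed

lemma slack_ordered_zero:
  assumes \<beta>: "\<beta> > 0" and small: "exp (K * T) * \<beta> * norm (1 :: real ^ 'd) \<le> 1 / 2"
  shows "slack_ordered 0 \<beta>"
proof -
  define S where "S = {N. 0 \<le> N \<and> slack_ordered N \<beta>}"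
  define M where "M = Inf S"
  have S: "2 * B \<in> S" using slack_ordered_large[of \<beta>] \<beta> B_nonneg by (simp add: S_def)
  have bdd: "bdd_below S" by (auto simp: S_def intro: bdd_belowI[of _ 0])
  have Sne: "S \<noteq> {}" using S by blast
  have M0: "0 \<le> M" unfolding M_def by (rule cInf_greatest[OF Sne]) (simp add: S_def)
  have "slack_ordered M \<beta>"
  proof (rule slack_ordered_closed[OF _ small])
    fix N' assume "M < N'"
    then obtain N where "N \<in> S" "N < N'" using cInf_less_iff[OF Sne bdd] unfolding M_def by blast
    then show "slack_ordered N' \<beta>" using slack_ordered_mono by (auto simp: S_def)
  qed (use \<beta> in simp)
  moreover have "\<not> slack_ordered N \<beta>" if "0 \<le> N" "N < M" for N
    using that cInf_lower[OF _ bdd, of N] by (auto simp: S_def M_def)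
  ultimately have "\<not> M > 0" using slack_level_not_critical[OF \<beta>, of M] by blast
  then show ?thesis using M0 \<open>slack_ordered M \<beta>\<close> by simp
qed

text \<open>
  For a given diagonal shift, \<open>\<beta>\<close> is chosen so small that the slack at the two shifted points is
  at most the shift, which makes the pair admissible.
\<close>

theorem comparison:
  assumes t: "t \<in> {0..T}"
  shows "u (t, x) \<le> v (t, x)"
  unfolding less_eq_vec_def
proof
  fix k
  have "u (t, x) $ k \<le> v (t, x) $ k + 0"
  proof (rule shift_limit[OF t])
    fix a b :: real assume ab: "0 \<le> a" "0 \<le> b" "0 < a + b"
    let ?x = "x + a *\<^sub>R 1" and ?y = "x - b *\<^sub>R 1"
    \<comment> \<open>The two summands of \<open>D\<close> correspond to the two smallness requirements on \<open>\<beta>\<close>.\<close>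
    define E where "E = exp (K * T)"
    define D where "D = 2 * norm (1 :: real ^ 'd) + (bracket ?x + bracket ?y) / (a + b)"
    define \<beta> where "\<beta> = 1 / (E * D)"
    have D: "0 < (bracket ?x + bracket ?y) / (a + b)"
      using ab bracket_ge_1[of ?x] bracket_ge_1[of ?y] by (intro divide_pos_pos) auto
    have E: "0 < E" by (simp add: E_def)
    have D0: "0 < D" using D by (simp add: D_def add_nonneg_pos)
    have \<beta>: "0 < \<beta>" using E D0 by (simp add: \<beta>_def)
    have "E * \<beta> = 1 / D" using E by (simp add: \<beta>_def)
    moreover have "2 * norm (1 :: real ^ 'd) \<le> D" using D by (simp add: D_def)
    ultimately have small: "E * \<beta> * norm (1 :: real ^ 'd) \<le> 1 / 2"
      using D0 by (simp only:) (simp add: divide_simps)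
    have "(bracket ?x + bracket ?y) / (a + b) \<le> D" by (simp add: D_def)
    then have "E * \<beta> * (bracket ?x + bracket ?y) \<le> a + b"
      unfolding \<open>E * \<beta> = 1 / D\<close> using D0 ab(3) by (simp add: divide_simps mult.commute)
    moreover have "slack 0 \<beta> t ?x ?y \<le> E * (\<beta> * (bracket ?x + bracket ?y))"
      unfolding slack_def E_def using exp_bounds[OF t] \<beta> bracket_ge_1[of ?x] bracket_ge_1[of ?y]
      by (intro mult_mono) auto
    ultimately have W: "slack 0 \<beta> t ?x ?y \<le> a + b" by (simp add: mult.assoc)
    have "?y $ j + slack 0 \<beta> t ?x ?y \<le> ?x $ j" for j using W by simp
    then have "u (t, ?x) $ k \<le> v (t, ?y) $ k + slack 0 \<beta> t ?x ?y"
      using slack_ordered_zero[OF \<beta>] small t unfolding slack_ordered_def E_def by blast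
    then show "u (t, ?x) $ k \<le> v (t, ?y) $ k + 0 + (a + b)" using W by linarith
  qed
  then show "u (t, x) $ k \<le> v (t, x) $ k" by simp
qed

end

section \<open>The comparison principle\<close>

lemma continuous_along_diagonal:
  fixes w :: "real \<times> (real ^ 'd) \<Rightarrow> real ^ 'm"
  assumes "continuous_on (time_space T) w" and "t \<in> {0..T}"
  shows "(\<lambda>n. w (t, x + (\<sigma> * inverse (real (Suc n))) *\<^sub>R 1) $ k) \<longlonglongrightarrow> w (t, x) $ k"
proof -
  have "(\<lambda>n. x + (\<sigma> * inverse (real (Suc n))) *\<^sub>R 1) \<longlonglongrightarrow> x + (\<sigma> * 0) *\<^sub>R 1"
    by (intro tendsto_intros LIMSEQ_inverse_real_of_nat)
  then have "(\<lambda>n. (t, x + (\<sigma> * inverse (real (Suc n))) *\<^sub>R 1)) \<longlonglongrightarrow> (t, x)"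
    by (intro tendsto_Pair) simp_all
  then have "(\<lambda>n. w (t, x + (\<sigma> * inverse (real (Suc n))) *\<^sub>R 1)) \<longlonglongrightarrow> w (t, x)"
    using assms by (intro continuous_on_tendsto_compose[OF assms(1)]) (auto simp: time_space_def)
  then show ?thesis by (rule tendsto_vec_nth)
qed

lemma diagonal_shift_limit:
  fixes u v :: "real \<times> (real ^ 'd) \<Rightarrow> real ^ 'm"
  assumes cont: "continuous_on (time_space T) u \<or> continuous_on (time_space T) v"
    and t: "t \<in> {0..T}"
    and shift: "\<And>a b. 0 \<le> a \<Longrightarrow> 0 \<le> b \<Longrightarrow> 0 < a + b \<Longrightarrow>
      u (t, x + a *\<^sub>R 1) $ k \<le> v (t, y - b *\<^sub>R 1) $ k + c + (a + b)"
  shows "u (t, x) $ k \<le> v (t, y) $ k + c"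
proof -
  let ?\<epsilon> = "\<lambda>n. inverse (real (Suc n))"
  have right: "(\<lambda>n. r + c + ?\<epsilon> n) \<longlonglongrightarrow> r + c + 0" for r :: real
    by (intro tendsto_intros LIMSEQ_inverse_real_of_nat)
  from cont show ?thesis
  proof
    assume "continuous_on (time_space T) u"
    from continuous_along_diagonal[OF this t, of x 1 k]
    have "(\<lambda>n. u (t, x + ?\<epsilon> n *\<^sub>R 1) $ k) \<longlonglongrightarrow> u (t, x) $ k" by simp
    moreover have "u (t, x + ?\<epsilon> n *\<^sub>R 1) $ k \<le> v (t, y) $ k + c + ?\<epsilon> n" for n
      using shift[of "?\<epsilon> n" 0] by simp
    ultimately show ?thesis using LIMSEQ_le[OF _ right] by simp
  next
    assume "continuous_on (time_space T) v"
    from continuous_along_diagonal[OF this t, of y "- 1" k]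
    have "(\<lambda>n. v (t, y - ?\<epsilon> n *\<^sub>R 1) $ k) \<longlonglongrightarrow> v (t, y) $ k" by simp
    then have "(\<lambda>n. v (t, y - ?\<epsilon> n *\<^sub>R 1) $ k + c + ?\<epsilon> n) \<longlonglongrightarrow> v (t, y) $ k + c + 0"
      by (rule tendsto_add[OF tendsto_add[OF _ tendsto_const] LIMSEQ_inverse_real_of_nat])
    moreover have "u (t, x) $ k \<le> v (t, y - ?\<epsilon> n *\<^sub>R 1) $ k + c + ?\<epsilon> n" for n
      using shift[of 0 "?\<epsilon> n"] by simp
    ultimately show ?thesis using LIMSEQ_le_const[of _ "v (t, y) $ k + c + 0"] by auto
  qed
qed

theorem theorem5p2:
  fixes T C\<^sub>0 :: real
    and f :: "real \<times> (real ^ 'd) \<times> (real ^ 'm) \<Rightarrow> real ^ 'd"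
    and g :: "real \<times> (real ^ 'd) \<times> (real ^ 'm) \<Rightarrow> real ^ 'm"
    and u v :: "real \<times> (real ^ 'd) \<Rightarrow> real ^ 'm"
  assumes "T > 0"
    and "\<exists>L. L-lipschitz_on (coeff_dom T) f" and "bounded (f ` coeff_dom T)"
    and "\<exists>L. L-lipschitz_on (coeff_dom T) g" and "bounded (g ` coeff_dom T)"
    and "C\<^sub>0 \<ge> 0"
    and "\<And>i j. ae_on_dom T (\<lambda>z. \<exists>D. has_partial_x (\<lambda>y. f y $ j) i D z \<and> D \<ge> - C\<^sub>0 * kronecker i j)"
    and "\<And>k l. ae_on_dom T (\<lambda>z. \<exists>D. has_partial_u (\<lambda>y. g y $ l) k D z \<and> D \<ge> - C\<^sub>0 * kronecker k l)"
    and "\<And>i l. ae_on_dom T (\<lambda>z. \<exists>D. has_partial_x (\<lambda>y. g y $ l) i D z \<and> D \<le> 0)"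
    and "\<And>k j. ae_on_dom T (\<lambda>z. \<exists>D. has_partial_u (\<lambda>y. f y $ j) k D z \<and> D \<le> 0)"
    and "bounded (u ` time_space T)" and "viscosity_subsolution T f g u"
    and "bounded (v ` time_space T)" and "viscosity_supersolution T f g v"
    and "continuous_on (time_space T) u \<and> lsc_on (time_space T) v \<or>
         usc_on (time_space T) u \<and> continuous_on (time_space T) v"
    and "\<forall>x. u (T, x) \<le> v (T, x)"
  shows "\<forall>t\<in>{0..T}. \<forall>x. u (t, x) \<le> v (t, x)"
proof (intro ballI allI)
  fix t x assume t: "t \<in> {0..T}"
  note f_lip = assms(2) and f_bdd = assms(3) and g_lip = assms(4)
    and f_x = assms(7) and g_u = assms(8) and g_x = assms(9) and f_u = assms(10)
    and u_bdd = assms(11) and u_sub = assms(12) and v_bdd = assms(13) and v_super = assms(14)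
    and cont = assms(15) and terminal = assms(16)
  obtain Lf Lg where Lf: "Lf-lipschitz_on (coeff_dom T) f" and Lg: "Lg-lipschitz_on (coeff_dom T) g"
    using f_lip g_lip by blast
  define L where "L = max Lf Lg"
  have f_L: "L-lipschitz_on (coeff_dom T) f" and g_L: "L-lipschitz_on (coeff_dom T) g"
    using lipschitz_on_mono[OF Lf order_refl] lipschitz_on_mono[OF Lg order_refl] by (auto simp: L_def)
  obtain F where "\<forall>z\<in>coeff_dom T. norm (f z) \<le> F"
    using f_bdd unfolding bounded_iff by blast
  then have F: "norm (f (t, x, p)) \<le> F" if "t \<in> {0..T}" for t x p
    using that by (simp add: coeff_dom_def)
  obtain Bu where "\<forall>z\<in>time_space T. norm (u z) \<le> Bu"
    using u_bdd unfolding bounded_iff by blast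
  then have Bu: "norm (u (t, x)) \<le> Bu" if "t \<in> {0..T}" for t x
    using that by (simp add: time_space_def)
  obtain Bv where "\<forall>z\<in>time_space T. norm (v z) \<le> Bv"
    using v_bdd unfolding bounded_iff by blast
  then have Bv: "norm (v (t, x)) \<le> Bv" if "t \<in> {0..T}" for t x
    using that by (simp add: time_space_def)
  have u_usc: "usc_on (time_space T) u" and v_lsc: "lsc_on (time_space T) v"
    using cont continuous_imp_usc_on continuous_imp_lsc_on by auto
  have u_env: "upper_env (time_space T) u (t, x) = u (t, x)"
    and v_env: "lower_env (time_space T) v (t, x) = v (t, x)" if "t \<in> {0..T}" for t x
    using upper_env_eq[OF u_bdd u_usc] lower_env_eq[OF v_bdd v_lsc] that by (auto simp: time_space_def)
  interpret comparison_setting T F L "max Bu Bv" "1 + F + L * (2 + 2 * norm (1 :: real ^ 'm))" f g u v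
  proof
    show "norm (f (t, x, p)) \<le> F" if "t \<in> {0..T}" for t x p using F that .
    show "f (t, y, p) $ j \<le> f (t, x, p) $ j"
      if "t \<in> {0..T}" "y \<le> x" "x $ j = y $ j" for t x y p j
    \<comment> \<open>The diagonal bound \<open>-C\<^sub>0\<close> gives no sign, so the \<open>j\<close>-th coordinate has to stay fixed.\<close>
    proof (rule coefficient_mono_x[OF \<open>T > 0\<close> component_lipschitz_on[OF f_L], where A = "- {j}"])
      show "ae_on_dom T (\<lambda>z. \<exists>D. has_partial_x (\<lambda>y. f y $ j) i D z \<and> D \<ge> 0)" if "i \<in> - {j}" for i
        using f_x[of j i] that by (simp add: kronecker_def)
    qed (use that in auto)
    show "f (t, x, p) $ j \<le> f (t, x, q) $ j" if "t \<in> {0..T}" "q \<le> p" for t x p q j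
    proof -
      have "- f (t, x, q) $ j \<le> - f (t, x, p) $ j"
      proof (rule coefficient_mono_u[OF \<open>T > 0\<close>, where A = UNIV and h = "\<lambda>z. - f z $ j"])
        show "L-lipschitz_on (coeff_dom T) (\<lambda>z. - f z $ j)"
          using component_lipschitz_on[OF f_L] by simp
        show "ae_on_dom T (\<lambda>z. \<exists>D. has_partial_u (\<lambda>z. - f z $ j) k D z \<and> D \<ge> 0)" for k
          using f_u[of j k] by eventually_elim (metis has_partial_u_uminus neg_0_le_iff_le)
      qed (use that in auto)
      then show ?thesis by simp
    qed
    show "g (t, x, p) $ l \<le> g (t, y, p) $ l" if "t \<in> {0..T}" "y \<le> x" for t x y p l
    proof -
      have "- g (t, y, p) $ l \<le> - g (t, x, p) $ l"
      proof (rule coefficient_mono_x[OF \<open>T > 0\<close>, where A = UNIV and h = "\<lambda>z. - g z $ l"])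
        show "L-lipschitz_on (coeff_dom T) (\<lambda>z. - g z $ l)"
          using component_lipschitz_on[OF g_L] by simp
        show "ae_on_dom T (\<lambda>z. \<exists>D. has_partial_x (\<lambda>z. - g z $ l) i D z \<and> D \<ge> 0)" for i
          using g_x[of l i] by eventually_elim (metis has_partial_x_uminus neg_0_le_iff_le)
      qed (use that in auto)
      then show ?thesis by simp
    qed
    show "g (t, x, q) $ l \<le> g (t, x, p) $ l"
      if "t \<in> {0..T}" "q \<le> p" "p $ l = q $ l" for t x p q l
    proof (rule coefficient_mono_u[OF \<open>T > 0\<close> component_lipschitz_on[OF g_L], where A = "- {l}"])
      show "ae_on_dom T (\<lambda>z. \<exists>D. has_partial_u (\<lambda>y. g y $ l) k D z \<and> D \<ge> 0)" if "k \<in> - {l}" for k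
        using g_u[of l k] that by (simp add: kronecker_def)
    qed (use that in auto)
    show "\<bar>u (t, x) $ k\<bar> \<le> max Bu Bv" if "t \<in> {0..T}" for t x k
      using Bu[OF that, of x] component_le_norm_cart[of "u (t, x)" k] by linarith
    show "\<bar>v (t, x) $ k\<bar> \<le> max Bu Bv" if "t \<in> {0..T}" for t x k
      using Bv[OF that, of x] component_le_norm_cart[of "v (t, x)" k] by linarith
    show "- \<phi>t (t, x) - f (t, x, u (t, x)) \<bullet> \<phi>x (t, x) - g (t, x, u (t, x)) $ i \<le> 0"
      if "C1_with_derivs T \<phi> \<phi>t \<phi>x" "t \<in> {0..<T}"
        "\<And>t' x'. t' \<in> {0..T} \<Longrightarrow> u (t', x') $ i - \<phi> (t', x') \<le> u (t, x) $ i - \<phi> (t, x)"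
      for \<phi> \<phi>t \<phi>x i t x
    proof -
      have "local_max_on (time_space T) (\<lambda>z. upper_env (time_space T) u z $ i - \<phi> z) (t, x)"
        unfolding local_max_on_def using that u_env
        by (auto simp: time_space_def intro!: exI[of _ 1])
      then show ?thesis
        using u_sub that(1,2) u_env[of t x] unfolding viscosity_subsolution_def by fastforce
    qed
    show "- \<phi>t (t, x) - f (t, x, v (t, x)) \<bullet> \<phi>x (t, x) - g (t, x, v (t, x)) $ i \<ge> 0"
      if "C1_with_derivs T \<phi> \<phi>t \<phi>x" "t \<in> {0..<T}"
        "\<And>t' x'. t' \<in> {0..T} \<Longrightarrow> v (t, x) $ i - \<phi> (t, x) \<le> v (t', x') $ i - \<phi> (t', x')"
      for \<phi> \<phi>t \<phi>x i t x
    proof -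
      have "local_min_on (time_space T) (\<lambda>z. lower_env (time_space T) v z $ i - \<phi> z) (t, x)"
        unfolding local_min_on_def using that v_env
        by (auto simp: time_space_def intro!: exI[of _ 1])
      then show ?thesis
        using v_super that(1,2) v_env[of t x] unfolding viscosity_supersolution_def by fastforce
    qed
    show "u (T, x) \<le> v (T, y)" if "y \<le> x" for x y
    proof -
      have "antimono (\<lambda>x. u (T, x))"
        using u_sub \<open>T > 0\<close> by (simp add: viscosity_subsolution_def)
      then have "u (T, x) \<le> u (T, y)" using that by (rule antimonoD)
      also have "\<dots> \<le> v (T, y)" using terminal by simp
      finally show ?thesis .
    qed
    show "u (t, x) $ k \<le> v (t, y) $ k + c"
      if "t \<in> {0..T}" "\<And>a b. 0 \<le> a \<Longrightarrow> 0 \<le> b \<Longrightarrow> 0 < a + b \<Longrightarrow>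
         u (t, x + a *\<^sub>R 1) $ k \<le> v (t, y - b *\<^sub>R 1) $ k + c + (a + b)" for t x y k c
      using cont diagonal_shift_limit[OF _ that] by blast
  qed (use \<open>T > 0\<close> f_L g_L u_usc v_lsc in auto)
  show "u (t, x) \<le> v (t, x)" using t by (rule comparison)
qed

end
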